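(* Let $N\ge3$ be divisible by $3$. In the discrete-time sensor model described in the context, let $T^G_h$ be the group-wise rule, i.e. the second smallest of the three group CUSUM alarm times $T^{\mathcal{G}_1}_h,T^{\mathcal{G}_2}_h,T^{\mathcal{G}_3}_h$ with threshold $h>0$. Then the detection delay scales with the average run length to false alarm in the following manner: as $h\to\infty$, $$d(T^G_h)\le\frac{2}{D(f_1\|f_0)N/3}\left(\log\mathrm{ARL}(T^G_h)+\log\frac{(1-\exp(-1))R_G^2D(f_1\|f_0)N/3}{\exp(-1)}+\beta_G+\kappa_G\right)+o(1).$$
   Context: **Model.** Time is integer-valued. There are $N\ge3$ sensors. Sensor $n\in\{1,\dots,N\}$ observes $\xi^{(n)}_k$, $k\ge1$; observations are independent over time and across sensors, with $\xi^{(n)}_k$ having density $f_0$ if $k\le\tau$ and density $f_1$ if $k>\tau$, where $\tau\in\{0,1,2,\dots\}\cup\{\infty\}$ is an unknown deterministic change time ($\tau=\infty$: no change) and $f_0,f_1$ are distinct known densities. One unknown sensor $n^c\in\{1,\dots,N\}$ may be compromised. Sensor $n$ reports $\bar\xi^{(n)}_k$ to a fusion center. If $n$ is honest then $\bar\xi^{(n)}=\xi^{(n)}$; for the compromised sensor, $\bar\xi^{(n^c)}$ is determined by an attack strategy $\mathfrak{s}$, which can use the signal $\xi^{(n^c)}$ observed by the attacker, and on which no assumption is made. Let $\mathcal{F}_k=\sigma\{(\bar\xi^{(1)}_l,\dots,\bar\xi^{(N)}_l):l\le k\}$. It is assumed that $\log\frac{f_1(\xi)}{f_0(\xi)}$ has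 finite second moment when $\xi\sim f_1$. $D(f_1\|f_0)$ is the Kullback–Leibler divergence $\int f_1\log(f_1/f_0)$. $E_{\tau,n^c,\mathfrak{s}}$ denotes expectation when the change occurs at $\tau$, the compromised sensor is $n^c$ and it uses strategy $\mathfrak{s}$. **Performance measures.** For a stopping time $T$ of $(\mathcal{F}_k)$, $$d(T)=\sup_{\tau<\infty,\,n^c,\,\mathfrak{s}}\operatorname{ess\,sup}\,E_{\tau,n^c,\mathfrak{s}}[(T-\tau)^+\mid\mathcal{F}_\tau],\qquad \mathrm{ARL}(T)=\inf_{n^c,\mathfrak{s}}E_{\infty,n^c,\mathfrak{s}}[T].$$ **Group-wise scheme.** Partition the $N$ sensors into three groups $\mathcal{G}_1,\mathcal{G}_2,\mathcal{G}_3$ of $N/3$ sensors each. For $i=1,2,3$ let $$u^{\mathcal{G}_i}_k=\sum_{l=1}^k\sum_{n\in\mathcal{G}_i}\log\frac{f_1(\bar\xi^{(n)}_l)}{f_0(\bar\xi^{(n)}_l)},\quad m^{\mathcal{G}_i}_k=\min_{1\le j\le k}u^{\mathcal{G}_i}_j,\quad y^{\mathcal{G}_i}_k=u^{\mathcal{G}_i}_k-m^{\mathcal{G}_i}_k,\quad T^{\mathcal{G}_i}_h=\inf\{k\ge1:y^{\mathcal{G}_i}_k\ge h\}.$$ $T^G_h$ is the second order statistic (second smallest value) of $T^{\mathcal{G}_1}_h,T^{\mathcal{G}_2}_h,T^{\mathcal{G}_3}_h$. **Constants.** Consider $N/3$ independent honest sequences $\xi^{(n)}_1,\xi^{(n)}_2,\dots$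 ($n=1,\dots,N/3$), each i.i.d. with density $f_1$ (change at time $0$), with expectation $E_0$. Put $u_k=\sum_{l=1}^k\sum_{n=1}^{N/3}\log\frac{f_1(\xi^{(n)}_l)}{f_0(\xi^{(n)}_l)}$, $m_k=\min_{1\le j\le k}u_j$, $m_\infty=\inf_{j\ge1}u_j$, $y_k=u_k-m_k$, $T_\nu=\inf\{k\ge1:y_k\ge\nu\}$, $\eta_\nu=\inf\{k\ge 1:u_k\ge\nu\}$. Then $$\kappa_G=\lim_{\nu\to\infty}E_0[y_{T_\nu}-\nu],\qquad \beta_G=E_0[m_\infty],\qquad R_G=\lim_{\nu\to\infty}E_0\left[\exp(-(u_{\eta_\nu}-\nu))\right],$$ the limits being assumed to exist. *)

theory Defs
  imports "HOL-Probability.Probability" "HOL-Library.Landau_Symbols"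
begin

section \<open>Observations\<close>

text \<open>
  Sensors are numbered from 1 to \<open>N\<close> and times are the naturals \<open>k \<ge> 1\<close>.  A signal is a sequence
  indexed by the times, and an array \<open>\<omega>\<close> of signals assigns the value \<open>\<omega> n k\<close> to sensor \<open>n\<close> at time
  \<open>k\<close>.  Single observations live in a measurable space \<open>M\<close> whose measure is the reference measure
  with respect to which \<open>f0\<close> and \<open>f1\<close> are densities.
\<close>

definition signal_space :: "'b measure \<Rightarrow> (nat \<Rightarrow> 'b) measure" where
  "signal_space M = PiM {1..} (\<lambda>k. M)"

definition array_space :: "nat set \<Rightarrow> 'b measure \<Rightarrow> (nat \<Rightarrow> nat \<Rightarrow> 'b) measure" where
  "array_space S M = PiM S (\<lambda>n. signal_space M)"

definition signal_law ::
  "'b measure \<Rightarrow> ('b \<Rightarrow> real) \<Rightarrow> ('b \<Rightarrow> real) \<Rightarrow> enat \<Rightarrow> (nat \<Rightarrow> 'b) measure" where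
  "signal_law M f0 f1 \<tau> =
     PiM {1..} (\<lambda>k. density M (\<lambda>x. ennreal (if enat k \<le> \<tau> then f0 x else f1 x)))"

definition observation_law ::
  "nat set \<Rightarrow> 'b measure \<Rightarrow> ('b \<Rightarrow> real) \<Rightarrow> ('b \<Rightarrow> real) \<Rightarrow> enat \<Rightarrow> (nat \<Rightarrow> nat \<Rightarrow> 'b) measure"
where
  "observation_law S M f0 f1 \<tau> = PiM S (\<lambda>n. signal_law M f0 f1 \<tau>)"


section \<open>Attacks and reports\<close>

text \<open>
  A strategy is an arbitrary Markov kernel from the signal of the compromised sensor to the
  signal it reports: any dependence on the observed signal and any private randomization is
  allowed, and no causality is imposed.  The honest sensor is the special case \<open>return\<close>.
\<close>

definition attack_strategies ::
  "'b measure \<Rightarrow> ((nat \<Rightarrow> 'b) \<Rightarrow> (nat \<Rightarrow> 'b) measure) set" where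
  "attack_strategies M = signal_space M \<rightarrow>\<^sub>M prob_algebra (signal_space M)"

text \<open>
  The probability law of the reports received by the fusion center, as a measure on the canonical
  space of arrays: the signals \<open>\<xi>\<close> are drawn, the compromised sensor \<open>nc\<close> draws \<open>r\<close> from
  \<open>s (\<xi> nc)\<close>, and the row \<open>nc\<close> of \<open>\<xi>\<close> is replaced by \<open>r\<close>.
\<close>

definition report_law ::
  "nat \<Rightarrow> 'b measure \<Rightarrow> ('b \<Rightarrow> real) \<Rightarrow> ('b \<Rightarrow> real) \<Rightarrow> enat \<Rightarrow> nat
     \<Rightarrow> ((nat \<Rightarrow> 'b) \<Rightarrow> (nat \<Rightarrow> 'b) measure) \<Rightarrow> (nat \<Rightarrow> nat \<Rightarrow> 'b) measure"
where
  "report_law N M f0 f1 \<tau> nc s =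
     observation_law {1..N} M f0 f1 \<tau> \<bind>
       (\<lambda>\<xi>. distr (s (\<xi> nc)) (array_space {1..N} M) (\<lambda>r. \<xi>(nc := r)))"

definition report_filtration :: "nat \<Rightarrow> 'b measure \<Rightarrow> nat \<Rightarrow> (nat \<Rightarrow> nat \<Rightarrow> 'b) measure" where
  "report_filtration N M k =
     vimage_algebra (space (array_space {1..N} M))
       (\<lambda>\<omega>. \<lambda>n\<in>{1..N}. \<lambda>l\<in>{1..k}. \<omega> n l)
       (PiM {1..N} (\<lambda>n. PiM {1..k} (\<lambda>l. M)))"


section \<open>Performance measures\<close>

text \<open>Subtraction on \<^typ>\<open>enat\<close> is truncated at 0, so \<open>T \<omega> - enat \<tau>\<close> is the positive part.\<close>

definition detection_delay ::
  "nat \<Rightarrow> 'b measure \<Rightarrow> ('b \<Rightarrow> real) \<Rightarrow> ('b \<Rightarrow> real) \<Rightarrow> ((nat \<Rightarrow> nat \<Rightarrow> 'b) \<Rightarrow> enat) \<Rightarrow> ennreal"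
where
  "detection_delay N M f0 f1 T =
     (SUP \<tau>::nat. SUP nc\<in>{1..N}. SUP s\<in>attack_strategies M.
        esssup (report_law N M f0 f1 (enat \<tau>) nc s)
          (nn_cond_exp (report_law N M f0 f1 (enat \<tau>) nc s) (report_filtration N M \<tau>)
             (\<lambda>\<omega>. ennreal_of_enat (T \<omega> - enat \<tau>))))"

definition ARL ::
  "nat \<Rightarrow> 'b measure \<Rightarrow> ('b \<Rightarrow> real) \<Rightarrow> ('b \<Rightarrow> real) \<Rightarrow> ((nat \<Rightarrow> nat \<Rightarrow> 'b) \<Rightarrow> enat) \<Rightarrow> ennreal"
where
  "ARL N M f0 f1 T =
     (INF nc\<in>{1..N}. INF s\<in>attack_strategies M.
        \<integral>\<^sup>+\<omega>. ennreal_of_enat (T \<omega>) \<partial>report_law N M f0 f1 \<infinity> nc s)"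

definition ln_ennreal :: "ennreal \<Rightarrow> ereal" where
  "ln_ennreal x = (if x = \<infinity> then \<infinity> else if x = 0 then - \<infinity> else ereal (ln (enn2real x)))"


section \<open>CUSUM statistics and the group-wise rule\<close>

text \<open>
  When \<open>f0\<close> and \<open>f1\<close> have the same support up to a null set, the log-likelihood ratio is finite
  at honest observations.  A compromised report outside the common support, where the ratio is
  infinite or undefined, counts as 0 because division by 0 and \<open>ln 0\<close> are 0.
\<close>

definition llr :: "('b \<Rightarrow> real) \<Rightarrow> ('b \<Rightarrow> real) \<Rightarrow> 'b \<Rightarrow> real" where
  "llr f0 f1 x = ln (f1 x / f0 x)"

definition llr_sum ::
  "('b \<Rightarrow> real) \<Rightarrow> ('b \<Rightarrow> real) \<Rightarrow> nat set \<Rightarrow> (nat \<Rightarrow> nat \<Rightarrow> 'b) \<Rightarrow> nat \<Rightarrow> real" where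
  "llr_sum f0 f1 S \<omega> k = (\<Sum>l=1..k. \<Sum>n\<in>S. llr f0 f1 (\<omega> n l))"

definition llr_min ::
  "('b \<Rightarrow> real) \<Rightarrow> ('b \<Rightarrow> real) \<Rightarrow> nat set \<Rightarrow> (nat \<Rightarrow> nat \<Rightarrow> 'b) \<Rightarrow> nat \<Rightarrow> real" where
  "llr_min f0 f1 S \<omega> k = Min (llr_sum f0 f1 S \<omega> ` {1..k})"

definition cusum ::
  "('b \<Rightarrow> real) \<Rightarrow> ('b \<Rightarrow> real) \<Rightarrow> nat set \<Rightarrow> (nat \<Rightarrow> nat \<Rightarrow> 'b) \<Rightarrow> nat \<Rightarrow> real" where
  "cusum f0 f1 S \<omega> k = llr_sum f0 f1 S \<omega> k - llr_min f0 f1 S \<omega> k"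

definition first_passage :: "(nat \<Rightarrow> real) \<Rightarrow> real \<Rightarrow> enat" where
  "first_passage z h = Inf (enat ` {k. 1 \<le> k \<and> h \<le> z k})"

definition groupwise_rule ::
  "('b \<Rightarrow> real) \<Rightarrow> ('b \<Rightarrow> real) \<Rightarrow> (nat \<Rightarrow> nat set) \<Rightarrow> real \<Rightarrow> (nat \<Rightarrow> nat \<Rightarrow> 'b) \<Rightarrow> enat" where
  "groupwise_rule f0 f1 G h \<omega> =
     sort (map (\<lambda>i. first_passage (cusum f0 f1 (G i) \<omega>) h) [1, 2, 3]) ! 1"


section \<open>Constants\<close>

text \<open>
  The expectations below are taken for \<open>K\<close> honest sensors under a change at time 0.  The first
  passage times are almost surely finite there; where they are infinite, \<^const>\<open>the_enat\<close> only
  picks some irrelevant time.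
\<close>

definition cusum_overshoot_mean ::
  "nat \<Rightarrow> 'b measure \<Rightarrow> ('b \<Rightarrow> real) \<Rightarrow> ('b \<Rightarrow> real) \<Rightarrow> real \<Rightarrow> real" where
  "cusum_overshoot_mean K M f0 f1 \<nu> =
     (\<integral>\<omega>. (let y = cusum f0 f1 {1..K} \<omega> in y (the_enat (first_passage y \<nu>)) - \<nu>)
        \<partial>observation_law {1..K} M f0 f1 0)"

definition llr_minimum_mean ::
  "nat \<Rightarrow> 'b measure \<Rightarrow> ('b \<Rightarrow> real) \<Rightarrow> ('b \<Rightarrow> real) \<Rightarrow> real" where
  "llr_minimum_mean K M f0 f1 =
     (\<integral>\<omega>. (INF j\<in>{1..}. llr_sum f0 f1 {1..K} \<omega> j) \<partial>observation_law {1..K} M f0 f1 0)"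

definition llr_overshoot_exp_mean ::
  "nat \<Rightarrow> 'b measure \<Rightarrow> ('b \<Rightarrow> real) \<Rightarrow> ('b \<Rightarrow> real) \<Rightarrow> real \<Rightarrow> real" where
  "llr_overshoot_exp_mean K M f0 f1 \<nu> =
     (\<integral>\<omega>. (let u = llr_sum f0 f1 {1..K} \<omega> in exp (- (u (the_enat (first_passage u \<nu>)) - \<nu>)))
        \<partial>observation_law {1..K} M f0 f1 0)"

end

theory Submission
  imports Defs "HOL-Real_Asymp.Real_Asymp"
begin

text \<open>
  The attacker controls one sensor, hence one of the three groups, and the other two groups run on
  honest observations.  The second alarm lies between the smaller and the larger of the two honest
  alarm times, whatever the third group does.  Let \<open>\<mu> = D * N / 3\<close> be the drift of the statistic
  of an honest group after the change.  That statistic needs about \<open>h / \<mu>\<close> steps to climb to \<open>h\<close>,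
  and the larger of two such passage times exceeds \<open>h / \<mu>\<close> only by a term of smaller order.  The
  average run length is of order \<open>exp h\<close>, so the right-hand side of the theorem is of order
  \<open>2 * h / \<mu>\<close>.  The two sides are thus separated by a gap that grows linearly in \<open>h\<close> and absorbs
  all bounded terms.  It is enough to prove, with some constants,

    \<^item> detection delay \<open>\<le> 3 / 2 * h / \<mu> + const\<close> (\<open>detection_delay_le\<close>), and
    \<^item> average run length \<open>\<ge> const * exp (7 / 8 * h)\<close> (\<open>ARL_ge\<close>),

  because \<open>3 / 2 < 2 * 7 / 8\<close>; then the error term \<open>\<epsilon> = 0\<close> works.

  Both estimates come from one number, the Chernoff coefficient
  \<open>\<rho> \<theta> = \<integral> f0^\<theta> * f1^(1 - \<theta>)\<close>.  It is the mean of \<open>exp (- \<theta> * llr)\<close> after the change and the mean of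
  \<open>exp ((1 - \<theta>) * llr)\<close> before it.  For a group of \<open>K = N / 3\<close> sensors, Markov's inequality bounds
  the probability that \<open>n\<close> steps after the change have not raised the statistic by \<open>h\<close> by
  \<open>exp (\<theta> * h) * \<rho> \<theta> ^ (K * n)\<close>, and the probability that \<open>d\<close> steps before the change have raised
  it by \<open>h\<close> by \<open>exp (- (1 - \<theta>) * h) * \<rho> \<theta> ^ (K * d)\<close>.  Both are geometric in the number of steps.
  Summing the first over \<open>n\<close> bounds the mean delay, and summing the second over all pairs of times
  up to \<open>n\<close> bounds the probability of a false alarm by time \<open>n\<close>.  Since \<open>ln (\<rho> \<theta>)\<close> behaves like
  \<open>- \<theta> * D\<close> for small \<open>\<theta>\<close>, some \<open>\<theta> \<le> 1 / 8\<close> gives the rates above (\<open>chernoff_small\<close>).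

  The delay is conditioned on the reports up to the change, and the compromised reports may depend on
  future observations.  But the attacker sees only its own signal, so that the future of the
  honest groups is independent of all that has been reported (\<open>honest_future_independent\<close>).
\<close>

section \<open>Independence on product spaces\<close>

text \<open>
  Tonelli's theorem for a single coordinate of a possibly infinite product.
\<close>

lemma nn_integral_PiM_remove:
  fixes P :: "'i \<Rightarrow> 'a measure"
  assumes P: "\<And>j. j \<in> I \<Longrightarrow> prob_space (P j)" and i: "i \<in> I"
    and F: "F \<in> borel_measurable (PiM I P)"
  shows "(\<integral>\<^sup>+X. F X \<partial>PiM I P) = (\<integral>\<^sup>+X. \<integral>\<^sup>+x. F (X(i := x)) \<partial>P i \<partial>PiM (I - {i}) P)"
proof -
  let ?J = "I - {i}"
  have I: "insert i ?J = I" using i by auto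
  interpret Pi: prob_space "P i" using P i by auto
  interpret PJ: prob_space "PiM ?J P" using P by (intro prob_space_PiM) auto
  interpret pair_sigma_finite "P i" "PiM ?J P" ..
  have upd: "(\<lambda>(x, X). X(i := x)) \<in> P i \<Otimes>\<^sub>M PiM ?J P \<rightarrow>\<^sub>M PiM I P"
    unfolding split_beta
    by (rule measurable_fun_upd[where J="?J"]) (use I in auto)
  have F': "(\<lambda>(x, X). F (X(i := x))) \<in> borel_measurable (P i \<Otimes>\<^sub>M PiM ?J P)"
    using measurable_compose[OF upd F] by (simp add: split_beta')
  have eq: "distr (P i \<Otimes>\<^sub>M PiM ?J P) (PiM I P) (\<lambda>(x, X). X(i := x)) = PiM I P"
    using distr_pair_PiM_eq_PiM[of ?J P i] P i unfolding I
    by simp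
  have "(\<integral>\<^sup>+X. F X \<partial>PiM I P) = (\<integral>\<^sup>+X. F X \<partial>distr (P i \<Otimes>\<^sub>M PiM ?J P) (PiM I P) (\<lambda>(x, X). X(i := x)))"
    by (simp add: eq)
  also have "\<dots> = (\<integral>\<^sup>+p. (\<lambda>(x, X). F (X(i := x))) p \<partial>(P i \<Otimes>\<^sub>M PiM ?J P))"
    by (subst nn_integral_distr[OF upd]) (use F in \<open>simp_all add: split_beta'\<close>)
  also have "\<dots> = (\<integral>\<^sup>+X. \<integral>\<^sup>+x. F (X(i := x)) \<partial>P i \<partial>PiM ?J P)"
    using nn_integral_snd[OF F'] by simp
  finally show ?thesis .
qed

text \<open>
  Independence of one coordinate from a function that ignores it, stated as a factorization of
  the integral so that it can be iterated.
\<close>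

lemma nn_integral_PiM_coordinate_times:
  fixes P :: "'i \<Rightarrow> 'a measure" and g F :: "_ \<Rightarrow> ennreal"
  assumes P: "\<And>j. j \<in> I \<Longrightarrow> prob_space (P j)" and i: "i \<in> I"
    and g: "g \<in> borel_measurable (P i)" and F: "F \<in> borel_measurable (PiM I P)"
    and indep: "\<And>X x. X \<in> space (PiM I P) \<Longrightarrow> x \<in> space (P i) \<Longrightarrow> F (X(i := x)) = F X"
  shows "(\<integral>\<^sup>+X. g (X i) * F X \<partial>PiM I P) = (\<integral>\<^sup>+x. g x \<partial>P i) * (\<integral>\<^sup>+X. F X \<partial>PiM I P)"
proof -
  let ?J = "I - {i}"
  interpret Pi: prob_space "P i" using P i by auto
  have upd: "X(i := x) \<in> space (PiM I P)" if "X \<in> space (PiM ?J P)" "x \<in> space (P i)" for X x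
    using that i by (auto simp: space_PiM PiE_def extensional_def Pi_def)
  obtain x0 where x0: "x0 \<in> space (P i)" using Pi.not_empty by auto
  \<comment> \<open>Since \<open>F\<close> ignores coordinate \<open>i\<close>, an arbitrary value \<open>x0\<close> may be put there.\<close>
  have F0: "F (X(i := x)) = F (X(i := x0))" if "X \<in> space (PiM ?J P)" "x \<in> space (P i)" for X x
    using indep[OF upd[OF that(1) x0] that(2)] by simp
  have "(\<lambda>X. X(i := x0)) \<in> PiM ?J P \<rightarrow>\<^sub>M PiM I P"
    by (rule measurable_fun_upd[where J="?J"]) (use i x0 in auto)
  then have F': "(\<lambda>X. F (X(i := x0))) \<in> borel_measurable (PiM ?J P)"
    by (rule measurable_compose) (rule F)
  have gi: "(\<lambda>X. g (X i)) \<in> borel_measurable (PiM I P)"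
    using measurable_component_singleton[OF i, of P] g by (rule measurable_compose)
  have "(\<integral>\<^sup>+X. F X \<partial>PiM I P) = (\<integral>\<^sup>+X. \<integral>\<^sup>+x. F (X(i := x)) \<partial>P i \<partial>PiM ?J P)"
    by (rule nn_integral_PiM_remove[OF P i F])
  also have "\<dots> = (\<integral>\<^sup>+X. F (X(i := x0)) \<partial>PiM ?J P)"
  proof (rule nn_integral_cong)
    fix X assume "X \<in> space (PiM ?J P)"
    then have "(\<integral>\<^sup>+x. F (X(i := x)) \<partial>P i) = (\<integral>\<^sup>+x. F (X(i := x0)) \<partial>P i)"
      using F0 by (intro nn_integral_cong) auto
    then show "(\<integral>\<^sup>+x. F (X(i := x)) \<partial>P i) = F (X(i := x0))"
      by (simp add: Pi.emeasure_space_1)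
  qed
  finally have FF: "(\<integral>\<^sup>+X. F X \<partial>PiM I P) = (\<integral>\<^sup>+X. F (X(i := x0)) \<partial>PiM ?J P)" .
  have "(\<integral>\<^sup>+X. g (X i) * F X \<partial>PiM I P) = (\<integral>\<^sup>+X. \<integral>\<^sup>+x. g x * F (X(i := x)) \<partial>P i \<partial>PiM ?J P)"
    by (subst nn_integral_PiM_remove[OF P i]) (use gi F in simp_all)
  also have "\<dots> = (\<integral>\<^sup>+X. (\<integral>\<^sup>+x. g x \<partial>P i) * F (X(i := x0)) \<partial>PiM ?J P)"
  proof (rule nn_integral_cong)
    fix X assume "X \<in> space (PiM ?J P)"
    then have "(\<integral>\<^sup>+x. g x * F (X(i := x)) \<partial>P i) = (\<integral>\<^sup>+x. g x * F (X(i := x0)) \<partial>P i)"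
      using F0 by (intro nn_integral_cong) auto
    also have "\<dots> = (\<integral>\<^sup>+x. g x \<partial>P i) * F (X(i := x0))"
      by (rule nn_integral_multc[OF g])
    finally show "(\<integral>\<^sup>+x. g x * F (X(i := x)) \<partial>P i) = (\<integral>\<^sup>+x. g x \<partial>P i) * F (X(i := x0))" .
  qed
  also have "\<dots> = (\<integral>\<^sup>+x. g x \<partial>P i) * (\<integral>\<^sup>+X. F X \<partial>PiM I P)"
    unfolding FF by (rule nn_integral_cmult[OF F'])
  finally show ?thesis .
qed

text \<open>
  An array is a product over sensors of products over times.  With all other sensors frozen by
  Tonelli's theorem, one entry is a coordinate of a single signal, and the preceding lemma applies.
\<close>

lemma nn_integral_PiM_PiM_entry_times:
  fixes Q :: "'l \<Rightarrow> 'a measure" and g :: "'a \<Rightarrow> ennreal" and F :: "('n \<Rightarrow> 'l \<Rightarrow> 'a) \<Rightarrow> ennreal"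
  assumes Q: "\<And>l. l \<in> T \<Longrightarrow> prob_space (Q l)" and n: "n \<in> S" and l: "l \<in> T"
    and g: "g \<in> borel_measurable (Q l)" and F: "F \<in> borel_measurable (PiM S (\<lambda>_. PiM T Q))"
    and indep: "\<And>\<xi> v. \<xi> \<in> space (PiM S (\<lambda>_. PiM T Q)) \<Longrightarrow> v \<in> space (Q l) \<Longrightarrow>
                  F (\<xi>(n := (\<xi> n)(l := v))) = F \<xi>"
  shows "(\<integral>\<^sup>+\<xi>. g (\<xi> n l) * F \<xi> \<partial>PiM S (\<lambda>_. PiM T Q)) =
         (\<integral>\<^sup>+x. g x \<partial>Q l) * (\<integral>\<^sup>+\<xi>. F \<xi> \<partial>PiM S (\<lambda>_. PiM T Q))"
proof -
  let ?P = "PiM T Q" and ?J = "S - {n}"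
  have P: "prob_space ?P" using Q by (rule prob_space_PiM)
  have upd: "X(n := x) \<in> space (PiM S (\<lambda>_. ?P))"
    if "X \<in> space (PiM ?J (\<lambda>_. ?P))" "x \<in> space ?P" for X x
    using that n by (auto simp: space_PiM PiE_def extensional_def Pi_def)
  have upd_meas: "(\<lambda>x. F (X(n := x))) \<in> borel_measurable ?P" if "X \<in> space (PiM ?J (\<lambda>_. ?P))" for X
  proof -
    have "(\<lambda>x. X(n := x)) \<in> ?P \<rightarrow>\<^sub>M PiM S (\<lambda>_. ?P)"
      by (rule measurable_fun_upd[where J="?J"]) (use n that in auto)
    then show ?thesis by (rule measurable_compose) (rule F)
  qed
  have upd2: "(\<lambda>(X, x). X(n := x)) \<in> PiM ?J (\<lambda>_. ?P) \<Otimes>\<^sub>M ?P \<rightarrow>\<^sub>M PiM S (\<lambda>_. ?P)"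
    unfolding split_beta by (rule measurable_fun_upd[where J="?J"]) (use n in auto)
  interpret P: prob_space ?P by (rule P)
  have inner: "(\<lambda>X. \<integral>\<^sup>+x. F (X(n := x)) \<partial>?P) \<in> borel_measurable (PiM ?J (\<lambda>_. ?P))"
    by (rule P.borel_measurable_nn_integral) (use measurable_compose[OF upd2 F] in \<open>simp add: split_beta'\<close>)
  have gn: "(\<lambda>\<xi>. g (\<xi> n l)) \<in> borel_measurable (PiM S (\<lambda>_. ?P))"
    using measurable_compose[OF measurable_component_singleton[OF n, of "\<lambda>_. ?P"]
        measurable_component_singleton[OF l, of Q]] g
    by (rule measurable_compose)
  have "(\<integral>\<^sup>+\<xi>. g (\<xi> n l) * F \<xi> \<partial>PiM S (\<lambda>_. ?P)) =
        (\<integral>\<^sup>+X. \<integral>\<^sup>+x. g (x l) * F (X(n := x)) \<partial>?P \<partial>PiM ?J (\<lambda>_. ?P))"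
    by (subst nn_integral_PiM_remove[OF P n]) (use gn F in simp_all)
  also have "\<dots> = (\<integral>\<^sup>+X. (\<integral>\<^sup>+x. g x \<partial>Q l) * (\<integral>\<^sup>+x. F (X(n := x)) \<partial>?P) \<partial>PiM ?J (\<lambda>_. ?P))"
  proof (rule nn_integral_cong)
    fix X assume X: "X \<in> space (PiM ?J (\<lambda>_. ?P))"
    show "(\<integral>\<^sup>+x. g (x l) * F (X(n := x)) \<partial>?P) = (\<integral>\<^sup>+x. g x \<partial>Q l) * (\<integral>\<^sup>+x. F (X(n := x)) \<partial>?P)"
    proof (rule nn_integral_PiM_coordinate_times[OF Q l g upd_meas[OF X]])
      fix x v assume "x \<in> space ?P" "v \<in> space (Q l)"
      then show "F (X(n := x(l := v))) = F (X(n := x))"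
        using indep[OF upd[OF X], of x v] by simp
    qed
  qed
  also have "\<dots> = (\<integral>\<^sup>+x. g x \<partial>Q l) * (\<integral>\<^sup>+X. (\<integral>\<^sup>+x. F (X(n := x)) \<partial>?P) \<partial>PiM ?J (\<lambda>_. ?P))"
    by (rule nn_integral_cmult[OF inner])
  also have "(\<integral>\<^sup>+X. (\<integral>\<^sup>+x. F (X(n := x)) \<partial>?P) \<partial>PiM ?J (\<lambda>_. ?P)) = (\<integral>\<^sup>+\<xi>. F \<xi> \<partial>PiM S (\<lambda>_. ?P))"
    by (rule nn_integral_PiM_remove[OF P n F, symmetric])
  finally show ?thesis .
qed

lemma nn_integral_PiM_PiM_prod_times:
  fixes Q :: "'l \<Rightarrow> 'a measure" and g :: "'a \<Rightarrow> ennreal" and F :: "('n \<Rightarrow> 'l \<Rightarrow> 'a) \<Rightarrow> ennreal"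
  assumes Q: "\<And>l. l \<in> T \<Longrightarrow> prob_space (Q l)"
    and B: "finite B" "B \<subseteq> S \<times> T"
    and g: "\<And>l. l \<in> T \<Longrightarrow> g \<in> borel_measurable (Q l)"
    and c: "\<And>n l. (n, l) \<in> B \<Longrightarrow> (\<integral>\<^sup>+x. g x \<partial>Q l) = c"
    and F: "F \<in> borel_measurable (PiM S (\<lambda>_. PiM T Q))"
    and indep: "\<And>n l \<xi> v. (n, l) \<in> B \<Longrightarrow> \<xi> \<in> space (PiM S (\<lambda>_. PiM T Q)) \<Longrightarrow> v \<in> space (Q l) \<Longrightarrow>
                  F (\<xi>(n := (\<xi> n)(l := v))) = F \<xi>"
  shows "(\<integral>\<^sup>+\<xi>. (\<Prod>(n, l)\<in>B. g (\<xi> n l)) * F \<xi> \<partial>PiM S (\<lambda>_. PiM T Q)) =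
         c ^ card B * (\<integral>\<^sup>+\<xi>. F \<xi> \<partial>PiM S (\<lambda>_. PiM T Q))"
  using B c indep
proof (induction B rule: finite_induct)
  case empty
  then show ?case by simp
next
  case (insert p B)
  obtain n l where p: "p = (n, l)" by force
  have nl: "n \<in> S" "l \<in> T" using insert.prems(1) p by auto
  let ?G = "\<lambda>\<xi>. (\<Prod>(n, l)\<in>B. g (\<xi> n l)) * F \<xi>"
  have meas: "(\<lambda>\<xi>. g (\<xi> n' l')) \<in> borel_measurable (PiM S (\<lambda>_. PiM T Q))"
    if "n' \<in> S" "l' \<in> T" for n' l'
    using measurable_compose[OF measurable_component_singleton[OF that(1), of "\<lambda>_. PiM T Q"]
        measurable_component_singleton[OF that(2), of Q]] g[OF that(2)]
    by (rule measurable_compose)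
  have G: "?G \<in> borel_measurable (PiM S (\<lambda>_. PiM T Q))"
    using insert.prems(1) meas F
    by (intro borel_measurable_times_ennreal borel_measurable_prod_ennreal) (auto simp: split_beta)
  have "(\<integral>\<^sup>+\<xi>. (\<Prod>(n, l)\<in>insert p B. g (\<xi> n l)) * F \<xi> \<partial>PiM S (\<lambda>_. PiM T Q)) =
        (\<integral>\<^sup>+\<xi>. g (\<xi> n l) * ?G \<xi> \<partial>PiM S (\<lambda>_. PiM T Q))"
    using insert.hyps by (simp add: p mult.assoc)
  also have "\<dots> = (\<integral>\<^sup>+x. g x \<partial>Q l) * (\<integral>\<^sup>+\<xi>. ?G \<xi> \<partial>PiM S (\<lambda>_. PiM T Q))"
  proof (rule nn_integral_PiM_PiM_entry_times[OF Q nl g[OF nl(2)] G])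
    fix \<xi> v assume "\<xi> \<in> space (PiM S (\<lambda>_. PiM T Q))" "v \<in> space (Q l)"
    then have "F (\<xi>(n := (\<xi> n)(l := v))) = F \<xi>"
      by (intro insert.prems(3)) (simp_all add: p)
    moreover have "(\<Prod>(n', l')\<in>B. g ((\<xi>(n := (\<xi> n)(l := v))) n' l')) = (\<Prod>(n', l')\<in>B. g (\<xi> n' l'))"
      using insert.hyps(2) by (intro prod.cong) (auto simp: p)
    ultimately show "?G (\<xi>(n := (\<xi> n)(l := v))) = ?G \<xi>" by simp
  qed
  also have "(\<integral>\<^sup>+x. g x \<partial>Q l) = c"
    using insert.prems(2)[of n l] p by simp
  also have "(\<integral>\<^sup>+\<xi>. ?G \<xi> \<partial>PiM S (\<lambda>_. PiM T Q)) = c ^ card B * (\<integral>\<^sup>+\<xi>. F \<xi> \<partial>PiM S (\<lambda>_. PiM T Q))"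
    using insert.prems by (intro insert.IH) auto
  finally show ?case
    using insert.hyps by (simp add: mult.assoc)
qed

section \<open>The law of the reports\<close>

locale change_model =
  fixes M :: "'b measure" and f0 f1 :: "'b \<Rightarrow> real"
  assumes sigma_finite: "sigma_finite_measure M"
    and f0_measurable [measurable]: "f0 \<in> borel_measurable M"
    and f1_measurable [measurable]: "f1 \<in> borel_measurable M"
    and f0_nonneg: "\<And>x. x \<in> space M \<Longrightarrow> 0 \<le> f0 x"
    and f1_nonneg: "\<And>x. x \<in> space M \<Longrightarrow> 0 \<le> f1 x"
    and f0_density: "prob_space (density M (\<lambda>x. ennreal (f0 x)))"
    and f1_density: "prob_space (density M (\<lambda>x. ennreal (f1 x)))"
    and support: "AE x in M. f0 x = 0 \<longleftrightarrow> f1 x = 0"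
begin

definition obs :: "enat \<Rightarrow> nat \<Rightarrow> 'b measure" where
  "obs \<tau> l = density M (\<lambda>x. ennreal (if enat l \<le> \<tau> then f0 x else f1 x))"

lemma prob_space_obs: "prob_space (obs \<tau> l)"
  using f0_density f1_density by (cases "enat l \<le> \<tau>") (simp_all add: obs_def)

lemma sets_obs [measurable_cong, simp]: "sets (obs \<tau> l) = sets M"
  by (simp add: obs_def)

lemma observation_law_eq: "observation_law S M f0 f1 \<tau> = PiM S (\<lambda>_. PiM {1..} (obs \<tau>))"
  unfolding observation_law_def signal_law_def obs_def ..

lemma sets_observation_law [measurable_cong]:
  "sets (observation_law S M f0 f1 \<tau>) = sets (array_space S M)"
  unfolding observation_law_eq array_space_def signal_space_def
  by (intro sets_PiM_cong) auto

lemma space_observation_law: "space (observation_law S M f0 f1 \<tau>) = space (array_space S M)"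
  by (rule sets_eq_imp_space_eq[OF sets_observation_law])

lemma prob_space_observation_law: "prob_space (observation_law S M f0 f1 \<tau>)"
  unfolding observation_law_eq by (intro prob_space_PiM prob_space_obs)

lemma entry_measurable [measurable]:
  assumes "n \<in> S" "1 \<le> l"
  shows "(\<lambda>\<omega>. \<omega> n l) \<in> array_space S M \<rightarrow>\<^sub>M M"
  using measurable_compose[OF measurable_component_singleton[OF assms(1), of "\<lambda>_. PiM {1..} (\<lambda>_. M)"]
      measurable_component_singleton[of l "{1..}" "\<lambda>_. M"]] assms(2)
  by (simp add: array_space_def signal_space_def)

context
  fixes N :: nat and nc :: nat and s :: "(nat \<Rightarrow> 'b) \<Rightarrow> (nat \<Rightarrow> 'b) measure"
  assumes nc: "nc \<in> {1..N}" and s: "s \<in> attack_strategies M"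
begin

lemma replace_measurable:
  "(\<lambda>(\<xi>, r). \<xi>(nc := r)) \<in> observation_law {1..N} M f0 f1 \<tau> \<Otimes>\<^sub>M signal_space M \<rightarrow>\<^sub>M array_space {1..N} M"
proof -
  have "fst \<in> observation_law {1..N} M f0 f1 \<tau> \<Otimes>\<^sub>M signal_space M \<rightarrow>\<^sub>M array_space {1..N} M"
    using measurable_fst[of "observation_law {1..N} M f0 f1 \<tau>" "signal_space M"]
    by (simp add: measurable_cong_sets[OF refl sets_observation_law])
  then show ?thesis
    unfolding split_beta array_space_def
    by (rule measurable_fun_upd[rotated]) (use nc in auto)
qed

lemma strategy_measurable:
  "(\<lambda>\<xi>. s (\<xi> nc)) \<in> observation_law {1..N} M f0 f1 \<tau> \<rightarrow>\<^sub>M prob_algebra (signal_space M)"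
proof -
  have "(\<lambda>\<xi>. \<xi> nc) \<in> observation_law {1..N} M f0 f1 \<tau> \<rightarrow>\<^sub>M signal_space M"
    unfolding measurable_cong_sets[OF sets_observation_law refl] array_space_def
    by (rule measurable_component_singleton[OF nc])
  then show ?thesis
    using s unfolding attack_strategies_def by (rule measurable_compose)
qed

lemma kernel_measurable:
  "(\<lambda>\<xi>. distr (s (\<xi> nc)) (array_space {1..N} M) (\<lambda>r. \<xi>(nc := r)))
     \<in> observation_law {1..N} M f0 f1 \<tau> \<rightarrow>\<^sub>M prob_algebra (array_space {1..N} M)"
  by (rule measurable_distr_prob_space2[OF strategy_measurable replace_measurable])

lemma sets_report_law [measurable_cong, simp]:
  "sets (report_law N M f0 f1 \<tau> nc s) = sets (array_space {1..N} M)"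
  unfolding report_law_def
proof (rule sets_bind)
  fix \<xi> show "sets (distr (s (\<xi> nc)) (array_space {1..N} M) (\<lambda>r. \<xi>(nc := r))) = sets (array_space {1..N} M)"
    by simp
next
  interpret prob_space "observation_law {1..N} M f0 f1 \<tau>" by (rule prob_space_observation_law)
  show "space (observation_law {1..N} M f0 f1 \<tau>) \<noteq> {}" by (rule not_empty)
qed

lemma space_report_law [simp]: "space (report_law N M f0 f1 \<tau> nc s) = space (array_space {1..N} M)"
  by (rule sets_eq_imp_space_eq) simp

lemma prob_space_report_law: "prob_space (report_law N M f0 f1 \<tau> nc s)"
proof -
  interpret prob_space "observation_law {1..N} M f0 f1 \<tau>" by (rule prob_space_observation_law)
  show ?thesis
    unfolding report_law_def
  proof (rule prob_space_bind)
    show "AE \<xi> in observation_law {1..N} M f0 f1 \<tau>.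
        prob_space (distr (s (\<xi> nc)) (array_space {1..N} M) (\<lambda>r. \<xi>(nc := r)))"
      using measurable_space[OF kernel_measurable] by (intro AE_I2) (simp add: space_prob_algebra)
  qed (rule measurable_prob_algebraD[OF kernel_measurable])
qed

text \<open>
  A mean over the reports is computed by drawing the honest array first and then the signal that
  replaces the compromised row.
\<close>

lemma nn_integral_report_law:
  assumes F: "F \<in> borel_measurable (array_space {1..N} M)"
  shows "(\<integral>\<^sup>+\<omega>. F \<omega> \<partial>report_law N M f0 f1 \<tau> nc s) =
         (\<integral>\<^sup>+\<xi>. \<integral>\<^sup>+r. F (\<xi>(nc := r)) \<partial>s (\<xi> nc) \<partial>observation_law {1..N} M f0 f1 \<tau>)"
  unfolding report_law_def
proof (subst nn_integral_bind[OF F measurable_prob_algebraD[OF kernel_measurable]], rule nn_integral_cong)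
  fix \<xi> assume \<xi>: "\<xi> \<in> space (observation_law {1..N} M f0 f1 \<tau>)"
  have "sets (s (\<xi> nc)) = sets (signal_space M)"
    using measurable_space[OF strategy_measurable \<xi>] by (simp add: space_prob_algebra)
  then have "(\<lambda>r. \<xi>(nc := r)) \<in> s (\<xi> nc) \<rightarrow>\<^sub>M array_space {1..N} M"
    using measurable_compose[OF measurable_Pair1'[OF \<xi>] replace_measurable]
    by (subst measurable_cong_sets[OF _ refl]) simp_all
  then show "(\<integral>\<^sup>+\<omega>. F \<omega> \<partial>distr (s (\<xi> nc)) (array_space {1..N} M) (\<lambda>r. \<xi>(nc := r))) =
             (\<integral>\<^sup>+r. F (\<xi>(nc := r)) \<partial>s (\<xi> nc))"
    using F by (simp add: nn_integral_distr)
qed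

lemma subalgebra_report_filtration:
  "subalgebra (report_law N M f0 f1 \<tau> nc s) (report_filtration N M t)"
  unfolding subalgebra_def
proof
  show "space (report_filtration N M t) = space (report_law N M f0 f1 \<tau> nc s)"
    by (simp add: report_filtration_def)
  have "(\<lambda>\<omega>. \<lambda>n\<in>{1..N}. \<lambda>l\<in>{1..t}. \<omega> n l)
      \<in> array_space {1..N} M \<rightarrow>\<^sub>M PiM {1..N} (\<lambda>n. PiM {1..t} (\<lambda>l. M))"
    by (intro measurable_restrict) auto
  then show "sets (report_filtration N M t) \<subseteq> sets (report_law N M f0 f1 \<tau> nc s)"
    unfolding report_filtration_def sets_report_law by (intro sets_image_in_sets) auto
qed

text \<open>
  Events of the filtration are preimages under the restriction to the first \<open>t\<close> columns, so they
  cannot separate arrays that agree there.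
\<close>

lemma report_filtration_cong:
  assumes A: "A \<in> sets (report_filtration N M t)"
    and \<omega>: "\<omega> \<in> space (array_space {1..N} M)" "\<omega>' \<in> space (array_space {1..N} M)"
    and eq: "\<And>n l. n \<in> {1..N} \<Longrightarrow> l \<in> {1..t} \<Longrightarrow> \<omega> n l = \<omega>' n l"
  shows "\<omega> \<in> A \<longleftrightarrow> \<omega>' \<in> A"
proof -
  let ?f = "\<lambda>\<omega>. \<lambda>n\<in>{1..N}. \<lambda>l\<in>{1..t}. \<omega> n l"
  have "?f \<in> space (array_space {1..N} M) \<rightarrow> space (PiM {1..N} (\<lambda>n. PiM {1..t} (\<lambda>l. M)))"
    by (auto simp: array_space_def signal_space_def space_PiM PiE_def Pi_def)
  then obtain B where "A = ?f -` B \<inter> space (array_space {1..N} M)"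
    using A unfolding report_filtration_def by (subst (asm) sets_vimage_algebra2) blast+
  moreover have "?f \<omega> = ?f \<omega>'"
    using eq by (intro restrict_ext) auto
  ultimately show ?thesis using \<omega> by auto
qed

text \<open>
  Average the event over the attack, with the observed array \<open>\<xi>\<close> fixed.  The resulting probability
  \<open>H \<xi>\<close> depends on the whole compromised signal, future included, but for the honest sensors only on
  the entries up to time \<open>t\<close>.  The honest entries after \<open>t\<close> are therefore independent of it and can be
  integrated out one at a time.
\<close>

lemma honest_future_independent:
  fixes g :: "'b \<Rightarrow> ennreal"
  assumes S: "S \<subseteq> {1..N} - {nc}" and L: "finite L" "L \<subseteq> {t<..}"
    and A: "A \<in> sets (report_filtration N M t)"
    and g [measurable]: "g \<in> borel_measurable M"
    and c: "\<And>l. l \<in> L \<Longrightarrow> (\<integral>\<^sup>+x. g x \<partial>obs \<tau> l) = c"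
  shows "(\<integral>\<^sup>+\<omega>. (\<Prod>(n, l)\<in>S \<times> L. g (\<omega> n l)) * indicator A \<omega> \<partial>report_law N M f0 f1 \<tau> nc s) =
         c ^ (card S * card L) * emeasure (report_law N M f0 f1 \<tau> nc s) A"
proof -
  let ?O = "observation_law {1..N} M f0 f1 \<tau>"
  let ?W = "\<lambda>\<xi>. \<Prod>(n, l)\<in>S \<times> L. g (\<xi> n l)"
  define H where "H \<xi> = (\<integral>\<^sup>+r. indicator A (\<xi>(nc := r)) \<partial>s (\<xi> nc))" for \<xi>
  have A' [measurable]: "A \<in> sets (array_space {1..N} M)"
    using A subalgebra_report_filtration[of \<tau> t] unfolding subalgebra_def by auto
  have W: "?W \<in> borel_measurable (array_space {1..N} M)"
  proof (rule borel_measurable_prod_ennreal)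
    fix p assume "p \<in> S \<times> L"
    then obtain n l where p: "p = (n, l)" "n \<in> {1..N}" "1 \<le> l"
      using subsetD[OF S] subsetD[OF L(2)] by (cases p) (auto simp: Suc_le_eq)
    show "(\<lambda>\<xi>. case p of (n, l) \<Rightarrow> g (\<xi> n l)) \<in> borel_measurable (array_space {1..N} M)"
      unfolding p prod.case by (rule measurable_compose[OF entry_measurable g]) (use p in auto)
  qed
  have H: "H \<in> borel_measurable ?O"
    unfolding H_def
  proof (rule nn_integral_measurable_subprob_algebra2[where N="signal_space M"])
    show "(\<lambda>(\<xi>, r). indicator A (\<xi>(nc := r)) :: ennreal) \<in> borel_measurable (?O \<Otimes>\<^sub>M signal_space M)"
      using measurable_compose[OF replace_measurable borel_measurable_indicator[OF A']]
      by (simp add: split_beta')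
  qed (rule measurable_prob_algebraD[OF strategy_measurable])
  have upd: "\<xi>(nc := r) \<in> space (array_space {1..N} M)"
    if "\<xi> \<in> space (array_space {1..N} M)" "r \<in> space (signal_space M)" for \<xi> r
    using that nc by (auto simp: array_space_def space_PiM PiE_def extensional_def Pi_def)
  have upd2: "\<xi>(n := (\<xi> n)(l := v)) \<in> space (array_space {1..N} M)"
    if "\<xi> \<in> space (array_space {1..N} M)" "v \<in> space M" "n \<in> {1..N}" "1 \<le> l" for \<xi> n l v
    using that by (auto simp: array_space_def signal_space_def space_PiM PiE_def extensional_def Pi_def)
  have space_s: "space (s (\<xi> nc)) = space (signal_space M)" if "\<xi> \<in> space (array_space {1..N} M)" for \<xi>
    using measurable_space[OF strategy_measurable[of \<tau>], of \<xi>] that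
    by (intro sets_eq_imp_space_eq) (simp add: space_prob_algebra space_observation_law)
  have "(\<integral>\<^sup>+\<omega>. ?W \<omega> * indicator A \<omega> \<partial>report_law N M f0 f1 \<tau> nc s) =
        (\<integral>\<^sup>+\<xi>. \<integral>\<^sup>+r. ?W (\<xi>(nc := r)) * indicator A (\<xi>(nc := r)) \<partial>s (\<xi> nc) \<partial>?O)"
    by (intro nn_integral_report_law borel_measurable_times_ennreal W borel_measurable_indicator A')
  also have "\<dots> = (\<integral>\<^sup>+\<xi>. ?W \<xi> * H \<xi> \<partial>?O)"
  proof (rule nn_integral_cong)
    fix \<xi> assume \<xi>: "\<xi> \<in> space ?O"
    have "?W (\<xi>(nc := r)) = ?W \<xi>" for r
      using S by (intro prod.cong) auto
    then have "(\<integral>\<^sup>+r. ?W (\<xi>(nc := r)) * indicator A (\<xi>(nc := r)) \<partial>s (\<xi> nc)) =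
               (\<integral>\<^sup>+r. ?W \<xi> * indicator A (\<xi>(nc := r)) \<partial>s (\<xi> nc))" by simp
    also have "\<dots> = ?W \<xi> * H \<xi>"
      unfolding H_def
    proof (rule nn_integral_cmult)
      have "(\<lambda>r. \<xi>(nc := r)) \<in> signal_space M \<rightarrow>\<^sub>M array_space {1..N} M"
        using measurable_compose[OF measurable_Pair1'[OF \<xi>] replace_measurable] by simp
      then have "(\<lambda>r. indicator A (\<xi>(nc := r)) :: ennreal) \<in> borel_measurable (signal_space M)"
        by (rule measurable_compose) (rule borel_measurable_indicator[OF A'])
      then show "(\<lambda>r. indicator A (\<xi>(nc := r)) :: ennreal) \<in> borel_measurable (s (\<xi> nc))"
        using measurable_space[OF strategy_measurable \<xi>]
        by (subst measurable_cong_sets[OF _ refl]) (simp_all add: space_prob_algebra)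
    qed
    finally show "(\<integral>\<^sup>+r. ?W (\<xi>(nc := r)) * indicator A (\<xi>(nc := r)) \<partial>s (\<xi> nc)) = ?W \<xi> * H \<xi>" .
  qed
  also have "\<dots> = c ^ card (S \<times> L) * (\<integral>\<^sup>+\<xi>. H \<xi> \<partial>?O)"
    unfolding observation_law_eq
  proof (rule nn_integral_PiM_PiM_prod_times[OF prob_space_obs])
    show "finite (S \<times> L)" using S L finite_subset[OF S] by auto
    have "L \<subseteq> {1..}" using L(2) by (rule order_trans) auto
    then show "S \<times> L \<subseteq> {1..N} \<times> {1..}" using S by (intro Sigma_mono) auto
    show "H \<in> borel_measurable (PiM {1..N} (\<lambda>_. PiM {1..} (obs \<tau>)))"
      using H by (simp add: observation_law_eq)
  next
    fix n l \<xi> v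
    assume nl: "(n, l) \<in> S \<times> L" and "\<xi> \<in> space (PiM {1..N} (\<lambda>_. PiM {1..} (obs \<tau>)))" and "v \<in> space (obs \<tau> l)"
    then have \<xi>: "\<xi> \<in> space (array_space {1..N} M)" and v: "v \<in> space M"
      by (simp_all only: observation_law_eq[symmetric] space_observation_law obs_def space_density)
    have n: "n \<in> {1..N}" "n \<noteq> nc" using nl S by auto
    have l: "t < l" using nl L(2) by auto
    then have l1: "1 \<le> l" by simp
    let ?\<xi> = "\<xi>(n := (\<xi> n)(l := v))"
    have "H ?\<xi> = (\<integral>\<^sup>+r. indicator A (?\<xi>(nc := r)) \<partial>s (\<xi> nc))"
      using n by (simp add: H_def)
    also have "\<dots> = H \<xi>"
      unfolding H_def
    proof (rule nn_integral_cong)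
      fix r assume "r \<in> space (s (\<xi> nc))"
      then have r: "r \<in> space (signal_space M)" using space_s[OF \<xi>] by simp
      have "?\<xi>(nc := r) \<in> A \<longleftrightarrow> \<xi>(nc := r) \<in> A"
        by (rule report_filtration_cong[OF A upd[OF upd2[OF \<xi> v n(1) l1] r] upd[OF \<xi> r]]) (use l in auto)
      then show "indicator A (?\<xi>(nc := r)) = (indicator A (\<xi>(nc := r)) :: ennreal)"
        by (simp add: indicator_def)
    qed
    finally show "H ?\<xi> = H \<xi>" .
  next
    show "g \<in> borel_measurable (obs \<tau> l)" for l using g by (simp add: obs_def)
  qed (use c in auto)
  also have "(\<integral>\<^sup>+\<xi>. H \<xi> \<partial>?O) = (\<integral>\<^sup>+\<omega>. indicator A \<omega> \<partial>report_law N M f0 f1 \<tau> nc s)"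
    unfolding H_def by (rule nn_integral_report_law[OF borel_measurable_indicator[OF A'], symmetric])
  also have "\<dots> = emeasure (report_law N M f0 f1 \<tau> nc s) A"
    by (rule nn_integral_indicator, unfold sets_report_law) (rule A')
  finally show ?thesis by (simp add: card_cartesian_product)
qed

end

end

section \<open>Alarm times along a path\<close>

text \<open>
  Two honest groups bracket the second alarm, whatever the third one does.
\<close>

lemma second_of_three:
  fixes a :: "nat \<Rightarrow> 'c::linorder"
  assumes "i \<in> {1, 2, 3}" "j \<in> {1, 2, 3}" "i \<noteq> j"
  shows "min (a i) (a j) \<le> sort (map a [1, 2, 3]) ! 1" "sort (map a [1, 2, 3]) ! 1 \<le> max (a i) (a j)"
  using assms by (auto simp: min_def max_def not_le)

lemma first_passage_gt_imp:
  assumes "enat b < first_passage z h" "1 \<le> b"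
  shows "z b < h"
proof (rule ccontr)
  assume "\<not> z b < h"
  then have "first_passage z h \<le> enat b"
    unfolding first_passage_def using assms(2) by (intro Inf_lower) auto
  then show False using assms(1) by simp
qed

lemma first_passage_le_imp:
  assumes "first_passage z h \<le> enat n"
  obtains k where "1 \<le> k" "k \<le> n" "h \<le> z k"
proof -
  have "first_passage z h < enat (Suc n)"
    using assms by (simp add: le_less_trans)
  then obtain k where "1 \<le> k" "h \<le> z k" "enat k < enat (Suc n)"
    unfolding first_passage_def by (auto simp: Inf_less_iff)
  then show thesis using that by simp
qed

lemma llr_sum_diff:
  assumes "a \<le> b"
  shows "llr_sum f0 f1 S \<omega> b - llr_sum f0 f1 S \<omega> a = (\<Sum>l\<in>{a<..b}. \<Sum>n\<in>S. llr f0 f1 (\<omega> n l))"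
proof -
  have "{1..b} = {1..a} \<union> {a<..b}" using assms by auto
  show ?thesis
    unfolding llr_sum_def by (subst \<open>{1..b} = _\<close>, subst sum.union_disjoint) auto
qed

text \<open>
  The running minimum is at most the value at any earlier time \<open>a\<close>.  So without an alarm the
  likelihood ratio has risen by less than \<open>h\<close> since \<open>a\<close>, and the past before \<open>a\<close> can be forgotten.
\<close>

lemma no_alarm_imp:
  assumes "enat b < first_passage (cusum f0 f1 S \<omega>) h" "1 \<le> a" "a \<le> b"
  shows "llr_sum f0 f1 S \<omega> b - llr_sum f0 f1 S \<omega> a < h"
proof -
  have "cusum f0 f1 S \<omega> b < h" using first_passage_gt_imp[OF assms(1)] assms by simp
  moreover have "llr_min f0 f1 S \<omega> b \<le> llr_sum f0 f1 S \<omega> a"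
    unfolding llr_min_def using assms by (intro Min_le) auto
  ultimately show ?thesis by (simp add: cusum_def)
qed

text \<open>
  An alarm at time \<open>k\<close> is a rise by \<open>h\<close> since the time \<open>a\<close> of the running minimum; \<open>d\<close> is the
  duration of that rise, which is positive since \<open>h\<close> is.
\<close>

lemma alarm_imp:
  assumes "first_passage (cusum f0 f1 S \<omega>) h \<le> enat n" "0 < h"
  obtains a d where "a \<in> {1..n}" "d \<in> {1..n}" "h \<le> llr_sum f0 f1 S \<omega> (a + d) - llr_sum f0 f1 S \<omega> a"
proof -
  obtain k where k: "1 \<le> k" "k \<le> n" "h \<le> cusum f0 f1 S \<omega> k"
    using first_passage_le_imp[OF assms(1)] .
  have "llr_min f0 f1 S \<omega> k \<in> llr_sum f0 f1 S \<omega> ` {1..k}"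
    unfolding llr_min_def using k by (intro Min_in) auto
  then obtain a where a: "1 \<le> a" "a \<le> k" "llr_min f0 f1 S \<omega> k = llr_sum f0 f1 S \<omega> a" by auto
  have "a \<noteq> k" using a k assms(2) by (auto simp: cusum_def)
  then have "1 \<le> k - a" using a by simp
  then show thesis
    using that[of a "k - a"] a k by (auto simp: cusum_def)
qed

lemma ennreal_of_enat_eq_suminf: "ennreal_of_enat x = (\<Sum>n. if enat n < x then 1 else 0)"
proof -
  have "emeasure (count_space {()}) (UNIV :: unit set) = 1" by (simp add: UNIV_unit)
  then show ?thesis
    using nn_integral_enat_function[of "\<lambda>_. x" "count_space {()}"]
    by (simp add: nn_integral_count_space_finite if_distrib cong: if_cong)
qed

text \<open>
  The tail sum formula for a mean, before integration.  It holds for every path, which makes it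
  usable for alarm times whose measurability is not known.
\<close>

lemma ennreal_of_enat_le_tail:
  "ennreal_of_enat x \<le> of_nat m + (\<Sum>n. if enat (n + m) < x then 1 else 0)"
proof -
  let ?f = "\<lambda>n. (if enat n < x then 1 else 0) :: ennreal"
  have "ennreal_of_enat x = (\<Sum>n. ?f (n + m)) + (\<Sum>n<m. ?f n)"
    unfolding ennreal_of_enat_eq_suminf by (rule suminf_offset) simp
  also have "(\<Sum>n<m. ?f n) \<le> (\<Sum>n<m. 1)" by (intro sum_mono) auto
  finally show ?thesis by (simp add: add.commute add_left_mono)
qed

section \<open>The Chernoff coefficient\<close>

text \<open>
  A Taylor bound that is integrable under \<open>f1\<close> with only a second moment of the log-likelihood
  ratio: on the negative side the remainder is controlled by \<open>exp (- x)\<close>, the inverse likelihood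
  ratio, whose mean under \<open>f1\<close> is 1.
\<close>

lemma exp_minus_le_quadratic:
  fixes s x :: real
  assumes "0 \<le> s" "s \<le> 1 / 2"
  shows "exp (- s * x) \<le> 1 - s * x + s\<^sup>2 * (x\<^sup>2 / 2 + 4 * exp (- x))"
proof (cases "0 \<le> x")
  case True
  define u where "u = s * x"
  have u: "0 \<le> u" using True assms by (simp add: u_def)
  have pos: "0 < 1 + u + u\<^sup>2 / 2" using u by (simp add: add_pos_nonneg)
  \<comment> \<open>\<open>exp (- u)\<close> is bounded by the inverse of the quadratic lower bound of \<open>exp u\<close>.\<close>
  have "(1 + u + u\<^sup>2 / 2) * (1 - u + u\<^sup>2 / 2) = 1 + u ^ 4 / 4"
    by (simp add: field_simps power2_eq_square power4_eq_xxxx)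
  then have "1 \<le> (1 - u + u\<^sup>2 / 2) * (1 + u + u\<^sup>2 / 2)" using u by (simp add: mult.commute)
  then have "1 / (1 + u + u\<^sup>2 / 2) \<le> 1 - u + u\<^sup>2 / 2" using pos by (simp add: divide_le_eq)
  moreover have "exp (- u) \<le> 1 / (1 + u + u\<^sup>2 / 2)"
    using exp_lower_Taylor_quadratic[OF u] pos
    by (simp add: exp_minus inverse_eq_divide frac_le)
  moreover have "0 \<le> s\<^sup>2 * (4 * exp (- x))" by simp
  ultimately have "exp (- u) \<le> 1 - u + u\<^sup>2 / 2 + s\<^sup>2 * (4 * exp (- x))" by linarith
  then show ?thesis
    by (simp add: u_def power_mult_distrib distrib_left)
next
  case False
  define t where "t = - x"
  have t: "0 < t" using False by (simp add: t_def)
  obtain v where v: "\<bar>v\<bar> \<le> \<bar>s * t\<bar>" "exp (s * t) = (\<Sum>m<2. (s * t) ^ m / fact m) + exp v / fact 2 * (s * t) ^ 2"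
    using Maclaurin_exp_le[of "s * t" 2] by blast
  have "s * t \<le> 1 / 2 * t" using assms t by (intro mult_right_mono) auto
  moreover have "\<bar>v\<bar> \<le> s * t" using v(1) t assms by (simp add: abs_mult)
  ultimately have "v \<le> t / 2" by linarith
  then have ev: "exp v \<le> exp (t / 2)" by simp
  have "(t / 2)\<^sup>2 / 2 \<le> exp (t / 2)"
    using exp_lower_Taylor_quadratic[of "t / 2"] t by simp
  then have "t\<^sup>2 \<le> 8 * exp (t / 2)" by (simp add: power_divide)
  then have "exp v * t\<^sup>2 \<le> exp (t / 2) * (8 * exp (t / 2))"
    using ev by (intro mult_mono) auto
  also have "\<dots> = 8 * exp t" by (simp flip: exp_add)
  finally have "s\<^sup>2 * (exp v * t\<^sup>2) \<le> s\<^sup>2 * (8 * exp t)" by (intro mult_left_mono) auto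
  moreover have "exp (s * t) = 1 + s * t + s\<^sup>2 * (exp v * t\<^sup>2) / 2"
    using v(2) by (simp add: numeral_2_eq_2 power_mult_distrib)
  moreover have "0 \<le> s\<^sup>2 * (x\<^sup>2 / 2)" by simp
  ultimately have "exp (s * t) \<le> 1 + s * t + s\<^sup>2 * (x\<^sup>2 / 2) + s\<^sup>2 * (4 * exp t)" by linarith
  then show ?thesis by (simp add: t_def distrib_left)
qed

context change_model
begin

text \<open>
  The Chernoff coefficient \<open>\<integral> f0^s * f1^(1 - s)\<close>.
\<close>

definition chernoff :: "real \<Rightarrow> ennreal" where
  "chernoff s = (\<integral>\<^sup>+x. ennreal (exp (- s * llr f0 f1 x)) \<partial>density M (\<lambda>x. ennreal (f1 x)))"

lemma llr_measurable [measurable]: "llr f0 f1 \<in> borel_measurable M"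
  unfolding llr_def by measurable

text \<open>
  Changing the measure from \<open>f0\<close> to \<open>f1\<close> divides by the likelihood ratio \<open>exp llr\<close>.  This makes one
  coefficient govern both the rises before the change and the failures to rise after it.
\<close>

lemma nn_integral_tilt:
  "(\<integral>\<^sup>+x. ennreal (exp ((1 - s) * llr f0 f1 x)) \<partial>density M (\<lambda>x. ennreal (f0 x))) = chernoff s"
proof -
  have "AE x in M. ennreal (f0 x) * ennreal (exp ((1 - s) * llr f0 f1 x)) =
                   ennreal (f1 x) * ennreal (exp (- s * llr f0 f1 x))"
    using support AE_space
  proof eventually_elim
    case (elim x)
    have nn: "0 \<le> f0 x" "0 \<le> f1 x" using f0_nonneg f1_nonneg elim by auto
    show ?case
    proof (cases "f0 x = 0")
      case False
      then have "0 < f0 x" "0 < f1 x" using elim nn by (auto simp: less_le)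
      then have "exp (llr f0 f1 x) = f1 x / f0 x" by (simp add: llr_def)
      moreover have "exp ((1 - s) * llr f0 f1 x) = exp (llr f0 f1 x) * exp (- s * llr f0 f1 x)"
        by (simp add: algebra_simps flip: exp_add)
      ultimately show ?thesis using nn False by (simp flip: ennreal_mult)
    qed (use elim in auto)
  qed
  then show ?thesis
    unfolding chernoff_def by (simp add: nn_integral_density nn_integral_cong_AE)
qed

lemma chernoff_obs_post: "enat l > \<tau> \<Longrightarrow> (\<integral>\<^sup>+x. ennreal (exp (- s * llr f0 f1 x)) \<partial>obs \<tau> l) = chernoff s"
  by (cases "enat l \<le> \<tau>") (simp_all add: chernoff_def obs_def)

lemma chernoff_obs_pre: "(\<integral>\<^sup>+x. ennreal (exp ((1 - s) * llr f0 f1 x)) \<partial>obs \<infinity> l) = chernoff s"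
  by (simp add: obs_def nn_integral_tilt)

context
  assumes distinct: "density M (\<lambda>x. ennreal (f0 x)) \<noteq> density M (\<lambda>x. ennreal (f1 x))"
    and second_moment: "integrable (density M (\<lambda>x. ennreal (f1 x))) (\<lambda>x. (llr f0 f1 x)\<^sup>2)"
begin

lemma integrable_llr: "integrable (density M (\<lambda>x. ennreal (f1 x))) (llr f0 f1)"
proof -
  interpret P1: prob_space "density M (\<lambda>x. ennreal (f1 x))" by (rule f1_density)
  show ?thesis by (rule P1.square_integrable_imp_integrable[OF _ second_moment]) simp
qed

lemma KL_eq_mean_llr:
  "KL_divergence (exp 1) (density M (\<lambda>x. ennreal (f0 x))) (density M (\<lambda>x. ennreal (f1 x))) =
   (\<integral>x. llr f0 f1 x \<partial>density M (\<lambda>x. ennreal (f1 x)))"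
proof -
  interpret sigma_finite_measure M by (rule sigma_finite)
  have nn: "AE x in M. 0 \<le> f0 x" "AE x in M. 0 \<le> f1 x" using f0_nonneg f1_nonneg by auto
  have "AE x in M. f0 x = 0 \<longrightarrow> f1 x = 0" using support by auto
  then have "KL_divergence (exp 1) (density M (\<lambda>x. ennreal (f0 x))) (density M (\<lambda>x. ennreal (f1 x))) =
      (\<integral>x. f1 x * log (exp 1) (f1 x / f0 x) \<partial>M)"
    using nn by (intro KL_density_density) auto
  then show ?thesis
    using nn by (simp add: integral_density llr_def log_def)
qed

lemma KL_pos:
  "0 < KL_divergence (exp 1) (density M (\<lambda>x. ennreal (f0 x))) (density M (\<lambda>x. ennreal (f1 x)))"
proof -
  interpret M: sigma_finite_measure M by (rule sigma_finite)
  let ?P0 = "density M (\<lambda>x. ennreal (f0 x))" and ?P1 = "density M (\<lambda>x. ennreal (f1 x))"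
  interpret P0: prob_space ?P0 by (rule f0_density)
  interpret P0: information_space ?P0 "exp 1" by standard simp
  have nn: "AE x in M. 0 \<le> f0 x" "AE x in M. 0 \<le> f1 x" using f0_nonneg f1_nonneg by auto
  have ac: "AE x in M. f0 x = 0 \<longrightarrow> f1 x = 0" using support by auto
  have P1: "density ?P0 (\<lambda>x. f1 x / f0 x) = ?P1"
    using nn ac by (intro density_density_divide) auto
  have "0 < KL_divergence (exp 1) ?P0 (density ?P0 (\<lambda>x. f1 x / f0 x))"
  proof (rule P0.KL_gt_0)
    show "prob_space (density ?P0 (\<lambda>x. f1 x / f0 x))" unfolding P1 by (rule f1_density)
    show "density ?P0 (\<lambda>x. f1 x / f0 x) \<noteq> ?P0" unfolding P1 using distinct by simp
    show "AE x in ?P0. 0 \<le> f1 x / f0 x"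
      using nn by (simp add: AE_density) (auto elim!: eventually_elim2)
    have "integrable M (\<lambda>x. f1 x * llr f0 f1 x)"
      using integrable_llr nn by (simp add: integrable_density)
    moreover have "AE x in M. f1 x * llr f0 f1 x = f0 x * (f1 x / f0 x * log (exp 1) (f1 x / f0 x))"
      using ac by eventually_elim (auto simp: llr_def log_def)
    ultimately have "integrable M (\<lambda>x. f0 x * (f1 x / f0 x * log (exp 1) (f1 x / f0 x)))"
      by (subst (asm) integrable_cong_AE) auto
    then show "integrable ?P0 (\<lambda>x. f1 x / f0 x * log (exp 1) (f1 x / f0 x))"
      using nn by (subst integrable_density) auto
  qed simp
  then show ?thesis by (simp only: P1)
qed

text \<open>
  By the quadratic bound, \<open>chernoff s \<le> 1 - s * D + s\<^sup>2 * C\<close>, so that the exponential rate is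
  close to \<open>s * D\<close> for small \<open>s\<close>.  The fraction 2/3 makes \<open>3 / 2 * h / \<mu>\<close> the time scale of the
  delay; the bound 1/8 on \<open>s\<close> makes \<open>7 / 8\<close> the exponent of the run length.
\<close>

lemma chernoff_small:
  defines "D \<equiv> KL_divergence (exp 1) (density M (\<lambda>x. ennreal (f0 x))) (density M (\<lambda>x. ennreal (f1 x)))"
  obtains s where "0 < s" "s \<le> 1 / 8" "chernoff s \<le> ennreal (exp (- (2 / 3) * s * D))"
proof -
  let ?P1 = "density M (\<lambda>x. ennreal (f1 x))" and ?l = "llr f0 f1"
  interpret P1: prob_space ?P1 by (rule f1_density)
  have D: "0 < D" "D = (\<integral>x. ?l x \<partial>?P1)" unfolding D_def by (rule KL_pos) (rule KL_eq_mean_llr)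
  have int_exp: "integrable ?P1 (\<lambda>x. exp (- ?l x))"
  proof (rule integrableI_nonneg)
    interpret P0: prob_space "density M (\<lambda>x. ennreal (f0 x))" by (rule f0_density)
    have "(\<integral>\<^sup>+x. ennreal (exp (- ?l x)) \<partial>?P1) = chernoff 1"
      by (simp add: chernoff_def)
    also have "\<dots> = 1"
      unfolding nn_integral_tilt[symmetric] by (simp add: P0.emeasure_space_1[simplified])
    finally show "(\<integral>\<^sup>+x. ennreal (exp (- ?l x)) \<partial>?P1) < \<infinity>" by simp
  qed auto
  define C where "C = (\<integral>x. (?l x)\<^sup>2 / 2 + 4 * exp (- ?l x) \<partial>?P1)"
  have int_C: "integrable ?P1 (\<lambda>x. (?l x)\<^sup>2 / 2 + 4 * exp (- ?l x))"
    using second_moment int_exp by auto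
  have C: "0 \<le> C" unfolding C_def by (intro integral_nonneg_AE) auto
  define s where "s = min (1 / 8) (D / (3 * (C + 1)))"
  have s: "0 < s" "s \<le> 1 / 8" unfolding s_def using D(1) C by (simp, intro min.cobounded1)
  have "s * (C + 1) \<le> D / 3"
  proof -
    have "s * (C + 1) \<le> D / (3 * (C + 1)) * (C + 1)"
      unfolding s_def using C by (intro mult_right_mono min.cobounded2) auto
    moreover have "D / (3 * c) * c = D / 3" if "0 < c" for c using that by simp
    ultimately show ?thesis using C by (metis add_nonneg_pos zero_less_one)
  qed
  then have sC: "s * C \<le> D / 3" using s by (simp add: algebra_simps)
  let ?q = "\<lambda>x. 1 - s * ?l x + s\<^sup>2 * ((?l x)\<^sup>2 / 2 + 4 * exp (- ?l x))"
  have q: "exp (- s * ?l x) \<le> ?q x" for x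
    using s by (intro exp_minus_le_quadratic) auto
  have q0: "0 \<le> ?q x" for x using q[of x] exp_ge_zero order_trans by blast
  have int_q: "integrable ?P1 ?q" using int_C integrable_llr by auto
  have "chernoff s \<le> (\<integral>\<^sup>+x. ennreal (?q x) \<partial>?P1)"
    unfolding chernoff_def using q by (intro nn_integral_mono ennreal_leI) auto
  also have "\<dots> = ennreal (\<integral>x. ?q x \<partial>?P1)"
    using int_q q0 by (intro nn_integral_eq_integral) auto
  also have "(\<integral>x. ?q x \<partial>?P1) = 1 - s * D + s\<^sup>2 * C"
    using int_C integrable_llr P1.prob_space by (simp add: D(2) C_def)
  also have "1 - s * D + s\<^sup>2 * C \<le> 1 + - (2 / 3) * s * D"
    using mult_left_mono[OF sC, of s] s by (simp add: power2_eq_square algebra_simps)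
  also have "\<dots> \<le> exp (- (2 / 3) * s * D)" by (rule exp_ge_add_one_self)
  finally have "chernoff s \<le> ennreal (exp (- (2 / 3) * s * D))" by (simp add: ennreal_leI)
  with s show thesis by (rule that)
qed

end

end

section \<open>The two performance measures\<close>

text \<open>
  Testing the hypothesis on the event where the conditional expectation exceeds \<open>C\<close> shows that
  this event is null.
\<close>

lemma (in sigma_finite_subalgebra) nn_cond_exp_le_const:
  assumes f [measurable]: "f \<in> borel_measurable M" and fin: "emeasure M (space M) < \<infinity>"
    and le: "\<And>A. A \<in> sets F \<Longrightarrow> (\<integral>\<^sup>+x. f x * indicator A x \<partial>M) \<le> ennreal C * emeasure M A"
  shows "AE x in M. nn_cond_exp M F f x \<le> ennreal C"
proof -
  let ?g = "nn_cond_exp M F f"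
  define A where "A = {x \<in> space F. ennreal C < ?g x}"
  have A [measurable]: "A \<in> sets F" unfolding A_def by measurable
  have A' [measurable]: "A \<in> sets M" using A subalg unfolding subalgebra_def by auto
  have finA: "emeasure M A < \<infinity>"
    using emeasure_space[of M A] fin by (rule le_less_trans)
  have "(\<integral>\<^sup>+x. (?g x - ennreal C) * indicator A x \<partial>M) + ennreal C * emeasure M A =
        (\<integral>\<^sup>+x. (?g x - ennreal C) * indicator A x + ennreal C * indicator A x \<partial>M)"
    by (simp add: nn_integral_add nn_integral_cmult)
  also have "\<dots> = (\<integral>\<^sup>+x. indicator A x * ?g x \<partial>M)"
    by (intro nn_integral_cong) (auto simp: A_def indicator_def diff_add_cancel_ennreal less_imp_le)
  also have "\<dots> = (\<integral>\<^sup>+x. indicator A x * f x \<partial>M)"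
    by (rule nn_cond_exp_intg) auto
  also have "\<dots> \<le> ennreal C * emeasure M A"
    using le[OF A] by (simp add: mult.commute)
  finally have "(\<integral>\<^sup>+x. (?g x - ennreal C) * indicator A x \<partial>M) + ennreal C * emeasure M A
      \<le> 0 + ennreal C * emeasure M A" by simp
  moreover have "ennreal C * emeasure M A < \<infinity>"
    using finA by (simp add: ennreal_mult_less_top)
  ultimately have "(\<integral>\<^sup>+x. (?g x - ennreal C) * indicator A x \<partial>M) = 0"
    by (cases "(\<integral>\<^sup>+x. (?g x - ennreal C) * indicator A x \<partial>M)"; cases "ennreal C * emeasure M A")
       (auto simp flip: ennreal_plus simp: top_unique ennreal_le_iff)
  then have "AE x in M. (?g x - ennreal C) * indicator A x = 0"
    by (subst (asm) nn_integral_0_iff_AE) auto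
  then show ?thesis
  proof (rule AE_mp, intro AE_I2 impI)
    fix x assume "x \<in> space M" "(?g x - ennreal C) * indicator A x = 0"
    moreover have "space F = space M" using subalg by (simp add: subalgebra_def)
    ultimately show "?g x \<le> ennreal C"
      by (auto simp: A_def indicator_def diff_eq_0_iff_ennreal not_less split: if_splits)
  qed
qed

context change_model
begin

lemma llr_sum_measurable:
  assumes "S \<subseteq> {1..N}"
  shows "(\<lambda>\<omega>. llr_sum f0 f1 S \<omega> k) \<in> borel_measurable (array_space {1..N} M)"
  unfolding llr_sum_def
proof (intro borel_measurable_sum)
  fix l n assume "l \<in> {1..k}" "n \<in> S"
  then show "(\<lambda>\<omega>. llr f0 f1 (\<omega> n l)) \<in> borel_measurable (array_space {1..N} M)"
    using assms by (intro measurable_compose[OF entry_measurable llr_measurable]) auto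
qed

lemma exp_increment_measurable:
  assumes "S \<subseteq> {1..N}"
  shows "(\<lambda>\<omega>. ennreal (exp (q * (llr_sum f0 f1 S \<omega> b - llr_sum f0 f1 S \<omega> a))))
    \<in> borel_measurable (array_space {1..N} M)"
  using llr_sum_measurable[OF assms, of b] llr_sum_measurable[OF assms, of a]
  by (intro measurable_compose[OF _ measurable_ennreal] borel_measurable_exp
      measurable_compose[OF _ borel_measurable_exp] borel_measurable_times borel_measurable_diff) auto

text \<open>
  The exponential moment of an increment of an honest group factorizes over sensors and times, and
  is independent of the reports before the increment.
\<close>

lemma honest_increment:
  assumes nc: "nc \<in> {1..N}" and s: "s \<in> attack_strategies M" and S: "S \<subseteq> {1..N} - {nc}"
    and A: "A \<in> sets (report_filtration N M t)" and t: "t \<le> a"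
    and c: "\<And>l. a < l \<Longrightarrow> (\<integral>\<^sup>+x. ennreal (exp (q * llr f0 f1 x)) \<partial>obs \<tau> l) = c"
  shows "(\<integral>\<^sup>+\<omega>. ennreal (exp (q * (llr_sum f0 f1 S \<omega> (a + d) - llr_sum f0 f1 S \<omega> a))) * indicator A \<omega>
            \<partial>report_law N M f0 f1 \<tau> nc s) =
         (c ^ card S) ^ d * emeasure (report_law N M f0 f1 \<tau> nc s) A"
proof -
  let ?L = "{a<..a + d}" and ?g = "\<lambda>x. ennreal (exp (q * llr f0 f1 x))"
  have "finite S" using finite_subset[OF S] by simp
  have "ennreal (exp (q * (llr_sum f0 f1 S \<omega> (a + d) - llr_sum f0 f1 S \<omega> a))) =
        (\<Prod>(n, l)\<in>S \<times> ?L. ?g (\<omega> n l))" for \<omega>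
  proof -
    have "q * (llr_sum f0 f1 S \<omega> (a + d) - llr_sum f0 f1 S \<omega> a) =
          (\<Sum>(n, l)\<in>S \<times> ?L. q * llr f0 f1 (\<omega> n l))"
      by (simp add: llr_sum_diff sum_distrib_left sum.swap[of _ S] flip: sum.cartesian_product)
    then show ?thesis
      using \<open>finite S\<close> by (simp add: exp_sum prod_ennreal split_beta)
  qed
  then have "(\<integral>\<^sup>+\<omega>. ennreal (exp (q * (llr_sum f0 f1 S \<omega> (a + d) - llr_sum f0 f1 S \<omega> a))) * indicator A \<omega>
            \<partial>report_law N M f0 f1 \<tau> nc s) =
      (\<integral>\<^sup>+\<omega>. (\<Prod>(n, l)\<in>S \<times> ?L. ?g (\<omega> n l)) * indicator A \<omega> \<partial>report_law N M f0 f1 \<tau> nc s)"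
    by simp
  also have "\<dots> = c ^ (card S * card ?L) * emeasure (report_law N M f0 f1 \<tau> nc s) A"
  proof (rule honest_future_independent[OF nc s S _ _ A])
    show "?L \<subseteq> {t<..}" using t by auto
    show "?g \<in> borel_measurable M" by measurable
  qed (use c in auto)
  finally show ?thesis by (simp add: power_mult)
qed

text \<open>
  The alarm time is bounded by the passage times of the increments after \<open>\<tau> + 1\<close>; starting
  one step late covers \<open>\<tau> = 0\<close>, where the running minimum has no value at time 0 to start from.  The
  first \<open>n0 + 1\<close> steps are counted in full.  After them, the Chernoff bound for each of the two groups
  has become at most 1 and decays geometrically, which contributes \<open>1 / (1 - r)\<close> per group.
\<close>

lemma conditional_delay_bound:
  fixes T :: "(nat \<Rightarrow> nat \<Rightarrow> 'b) \<Rightarrow> enat"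
  assumes nc: "nc \<in> {1..N}" and s: "s \<in> attack_strategies M"
    and S: "S \<subseteq> {1..N} - {nc}" "S' \<subseteq> {1..N} - {nc}" "card S = K" "card S' = K"
    and T: "\<And>\<omega>. T \<omega> \<le> max (first_passage (cusum f0 f1 S \<omega>) h) (first_passage (cusum f0 f1 S' \<omega>) h)"
    and \<theta>: "0 < \<theta>" and r: "0 \<le> r" "r < 1" "chernoff \<theta> ^ K \<le> ennreal r"
    and n0: "exp (\<theta> * h) * r ^ n0 \<le> 1"
    and A: "A \<in> sets (report_filtration N M \<tau>)"
  shows "(\<integral>\<^sup>+\<omega>. ennreal_of_enat (T \<omega> - enat \<tau>) * indicator A \<omega> \<partial>report_law N M f0 f1 (enat \<tau>) nc s)
    \<le> ennreal (real n0 + 1 + 2 / (1 - r)) * emeasure (report_law N M f0 f1 (enat \<tau>) nc s) A"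
proof -
  let ?P = "report_law N M f0 f1 (enat \<tau>) nc s" and ?a = "\<tau> + 1"
  \<comment> \<open>\<open>e S n\<close> is at least 1 on the paths on which group \<open>S\<close> has not yet alarmed at time
    \<open>\<tau> + 1 + n + n0\<close>, so it stands in for the indicator of a late alarm.\<close>
  define e where "e S n \<omega> = ennreal (exp (\<theta> * h)) *
    ennreal (exp (- \<theta> * (llr_sum f0 f1 S \<omega> (?a + (n + n0)) - llr_sum f0 f1 S \<omega> ?a)))" for S n \<omega>
  have A' [measurable]: "A \<in> sets ?P"
    using A subalgebra_report_filtration[OF nc s] unfolding subalgebra_def by blast
  have e_meas: "e S n \<in> borel_measurable ?P" if "S \<subseteq> {1..N} - {nc}" for S n
    unfolding e_def measurable_cong_sets[OF sets_report_law[OF nc s] refl]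
    using that by (intro borel_measurable_times_ennreal borel_measurable_const exp_increment_measurable) auto
  have e_int: "(\<integral>\<^sup>+\<omega>. e S n \<omega> * indicator A \<omega> \<partial>?P) \<le> ennreal (r ^ n) * emeasure ?P A"
    if S: "S \<subseteq> {1..N} - {nc}" "card S = K" for S n
  proof -
    have meas: "(\<lambda>\<omega>. ennreal (exp (- \<theta> * (llr_sum f0 f1 S \<omega> (?a + (n + n0)) - llr_sum f0 f1 S \<omega> ?a)))
        * indicator A \<omega>) \<in> borel_measurable ?P"
      unfolding measurable_cong_sets[OF sets_report_law[OF nc s] refl]
      using that A' sets_report_law[OF nc s]
      by (intro borel_measurable_times_ennreal borel_measurable_indicator exp_increment_measurable) auto
    have "(\<integral>\<^sup>+\<omega>. e S n \<omega> * indicator A \<omega> \<partial>?P) =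
        ennreal (exp (\<theta> * h)) * ((chernoff \<theta> ^ K) ^ (n + n0) * emeasure ?P A)"
      unfolding e_def mult.assoc nn_integral_cmult[OF meas]
      using S honest_increment[OF nc s S(1) A, where a="?a" and q="- \<theta>" and \<tau>="enat \<tau>" and c="chernoff \<theta>" and d="n + n0"]
        chernoff_obs_post[of "enat \<tau>" _ \<theta>] by simp
    also have "\<dots> \<le> ennreal (exp (\<theta> * h)) * (ennreal r ^ (n + n0) * emeasure ?P A)"
      using r(3) by (intro mult_left_mono mult_right_mono power_mono) auto
    also have "\<dots> = ennreal (exp (\<theta> * h) * r ^ n0 * r ^ n) * emeasure ?P A"
      using r(1) by (simp add: ennreal_power ennreal_mult power_add mult_ac)
    also have "\<dots> \<le> ennreal (1 * r ^ n) * emeasure ?P A"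
      using n0 r(1) by (intro mult_right_mono ennreal_leI) auto
    finally show ?thesis by simp
  qed
  have e_ge: "1 \<le> e S n \<omega>"
    if "enat (?a + (n + n0)) < first_passage (cusum f0 f1 S \<omega>) h" for S n \<omega>
  proof -
    let ?d = "llr_sum f0 f1 S \<omega> (?a + (n + n0)) - llr_sum f0 f1 S \<omega> ?a"
    have "?d < h" by (rule no_alarm_imp[OF that]) auto
    then have "\<theta> * ?d \<le> \<theta> * h" using \<theta> by (intro mult_left_mono) auto
    then have "1 \<le> exp (\<theta> * h + - \<theta> * ?d)" by simp
    also have "\<dots> = exp (\<theta> * h) * exp (- \<theta> * ?d)" by (rule exp_add)
    finally show ?thesis unfolding e_def by (simp flip: ennreal_mult)
  qed
  have le: "ennreal_of_enat (T \<omega> - enat \<tau>) \<le> of_nat (n0 + 1) + (\<Sum>n. e S n \<omega> + e S' n \<omega>)" for \<omega>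
  proof -
    have "(if enat (n + (n0 + 1)) < T \<omega> - enat \<tau> then 1 else 0) \<le> e S n \<omega> + e S' n \<omega>" for n
    proof (cases "enat (n + (n0 + 1)) < T \<omega> - enat \<tau>")
      case True
      then have "enat (?a + (n + n0)) < T \<omega>" by (cases "T \<omega>") auto
      also note T
      finally have "1 \<le> e S n \<omega> \<or> 1 \<le> e S' n \<omega>"
        using e_ge[of n S \<omega>] e_ge[of n S' \<omega>] by (auto simp: less_max_iff_disj)
      then have "1 \<le> e S n \<omega> + e S' n \<omega>"
        by (auto intro: order_trans simp: add_increasing add_increasing2)
      then show ?thesis by simp
    qed simp
    then have "(\<Sum>n. if enat (n + (n0 + 1)) < T \<omega> - enat \<tau> then 1 else 0) \<le> (\<Sum>n. e S n \<omega> + e S' n \<omega>)"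
      by (intro suminf_le) auto
    then show ?thesis
      using ennreal_of_enat_le_tail[of "T \<omega> - enat \<tau>" "n0 + 1"] by (meson add_left_mono order_trans)
  qed
  note [measurable] = e_meas[OF S(1)] e_meas[OF S(2)]
  have "(\<integral>\<^sup>+\<omega>. ennreal_of_enat (T \<omega> - enat \<tau>) * indicator A \<omega> \<partial>?P)
      \<le> (\<integral>\<^sup>+\<omega>. of_nat (n0 + 1) * indicator A \<omega>
            + (\<Sum>n. e S n \<omega> * indicator A \<omega> + e S' n \<omega> * indicator A \<omega>) \<partial>?P)"
    using le by (intro nn_integral_mono) (auto simp: indicator_def)
  also have "\<dots> = of_nat (n0 + 1) * emeasure ?P A
      + (\<Sum>n. (\<integral>\<^sup>+\<omega>. e S n \<omega> * indicator A \<omega> \<partial>?P) + (\<integral>\<^sup>+\<omega>. e S' n \<omega> * indicator A \<omega> \<partial>?P))"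
    by (simp add: nn_integral_add nn_integral_suminf nn_integral_cmult)
  also have "\<dots> \<le> of_nat (n0 + 1) * emeasure ?P A + (\<Sum>n. ennreal (2 * r ^ n) * emeasure ?P A)"
  proof (intro add_left_mono suminf_le)
    fix n
    have "(\<integral>\<^sup>+\<omega>. e S n \<omega> * indicator A \<omega> \<partial>?P) + (\<integral>\<^sup>+\<omega>. e S' n \<omega> * indicator A \<omega> \<partial>?P)
        \<le> ennreal (r ^ n) * emeasure ?P A + ennreal (r ^ n) * emeasure ?P A"
      using S by (intro add_mono e_int) auto
    also have "\<dots> = ennreal (2 * r ^ n) * emeasure ?P A"
      using r(1) by (simp add: ennreal_plus[symmetric] del: ennreal_plus flip: distrib_right)
    finally show "(\<integral>\<^sup>+\<omega>. e S n \<omega> * indicator A \<omega> \<partial>?P) + (\<integral>\<^sup>+\<omega>. e S' n \<omega> * indicator A \<omega> \<partial>?P)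
        \<le> ennreal (2 * r ^ n) * emeasure ?P A" .
  qed auto
  also have "(\<Sum>n. ennreal (2 * r ^ n) * emeasure ?P A) = ennreal (2 / (1 - r)) * emeasure ?P A"
  proof -
    have "(\<lambda>n. 2 * r ^ n) sums (2 * (1 / (1 - r)))"
      using r by (intro sums_mult geometric_sums) auto
    then have "(\<Sum>n. ennreal (2 * r ^ n)) = ennreal (2 / (1 - r))"
      using r(1) by (intro suminf_ennreal_eq) auto
    then show ?thesis by simp
  qed
  also have "of_nat (n0 + 1) * emeasure ?P A + ennreal (2 / (1 - r)) * emeasure ?P A =
      ennreal (real n0 + 1 + 2 / (1 - r)) * emeasure ?P A"
  proof -
    have "of_nat (n0 + 1) = ennreal (real n0 + 1)"
      by (metis ennreal_of_nat_eq_real_of_nat of_nat_1 of_nat_add)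
    then show ?thesis using r by (simp add: ennreal_plus distrib_right del: of_nat_add of_nat_Suc)
  qed
  finally show ?thesis .
qed

text \<open>
  The union bound over the start \<open>a\<close> and the duration \<open>d\<close> of a rise by \<open>h\<close>.  The sum over
  durations is geometric, so the probability of an alarm before time \<open>n\<close> is at most
  \<open>2 * n * exp (- (1 - \<theta>) * h) / (1 - r)\<close>.  The assumption on \<open>n\<close> makes it at most \<open>1 / 2\<close>, and then the
  mean alarm time is at least \<open>n / 2\<close>.
\<close>

lemma run_length_bound:
  fixes T :: "(nat \<Rightarrow> nat \<Rightarrow> 'b) \<Rightarrow> enat"
  assumes nc: "nc \<in> {1..N}" and s: "s \<in> attack_strategies M"
    and S: "S \<subseteq> {1..N} - {nc}" "S' \<subseteq> {1..N} - {nc}" "card S = K" "card S' = K"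
    and T: "\<And>\<omega>. min (first_passage (cusum f0 f1 S \<omega>) h) (first_passage (cusum f0 f1 S' \<omega>) h) \<le> T \<omega>"
    and h: "0 < h" and \<theta>: "\<theta> < 1" and r: "0 \<le> r" "r < 1" "chernoff \<theta> ^ K \<le> ennreal r"
    and n: "real n \<le> (1 - r) / 4 * exp ((1 - \<theta>) * h)"
  shows "ennreal (real n / 2) \<le> (\<integral>\<^sup>+\<omega>. ennreal_of_enat (T \<omega>) \<partial>report_law N M f0 f1 \<infinity> nc s)"
proof -
  let ?P = "report_law N M f0 f1 \<infinity> nc s"
  interpret P: prob_space ?P by (rule prob_space_report_law[OF nc s])
  \<comment> \<open>\<open>w S a d\<close> is at least 1 on the paths on which the statistic of group \<open>S\<close> rises by \<open>h\<close> from
    time \<open>a\<close> to time \<open>a + d\<close>.\<close>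
  define w where "w S a d \<omega> = ennreal (exp (- (1 - \<theta>) * h)) *
    ennreal (exp ((1 - \<theta>) * (llr_sum f0 f1 S \<omega> (a + d) - llr_sum f0 f1 S \<omega> a)))" for S a d \<omega>
  define W where "W \<omega> = (\<Sum>a=1..n. \<Sum>d=1..n. w S a d \<omega> + w S' a d \<omega>)" for \<omega>
  have w_meas: "w S a d \<in> borel_measurable ?P" if "S \<subseteq> {1..N} - {nc}" for S a d
    unfolding w_def measurable_cong_sets[OF sets_report_law[OF nc s] refl]
    using that by (intro borel_measurable_times_ennreal borel_measurable_const exp_increment_measurable) auto
  have w_int: "(\<integral>\<^sup>+\<omega>. w S a d \<omega> \<partial>?P) \<le> ennreal (exp (- (1 - \<theta>) * h) * r ^ d)"
    if S: "S \<subseteq> {1..N} - {nc}" "card S = K" for S a d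
  proof -
    let ?i = "\<lambda>\<omega>. ennreal (exp ((1 - \<theta>) * (llr_sum f0 f1 S \<omega> (a + d) - llr_sum f0 f1 S \<omega> a)))"
    have meas: "?i \<in> borel_measurable ?P"
      unfolding measurable_cong_sets[OF sets_report_law[OF nc s] refl]
      using that by (intro exp_increment_measurable) auto
    have sp: "space ?P \<in> sets (report_filtration N M 0)"
      using subalgebra_report_filtration[OF nc s, of \<infinity> 0] unfolding subalgebra_def
      by (metis sets.top)
    have "(\<integral>\<^sup>+\<omega>. ?i \<omega> \<partial>?P) = (\<integral>\<^sup>+\<omega>. ?i \<omega> * indicator (space ?P) \<omega> \<partial>?P)"
      by (intro nn_integral_cong) simp
    also have "\<dots> = (chernoff \<theta> ^ card S) ^ d * emeasure ?P (space ?P)"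
      by (rule honest_increment[OF nc s S(1) sp]) (simp_all add: chernoff_obs_pre)
    also have "\<dots> = (chernoff \<theta> ^ K) ^ d" by (simp add: P.emeasure_space_1 S(2) del: space_report_law)
    also have "\<dots> \<le> ennreal r ^ d" using r(3) by (intro power_mono) auto
    finally have "ennreal (exp (- (1 - \<theta>) * h)) * (\<integral>\<^sup>+\<omega>. ?i \<omega> \<partial>?P) \<le>
        ennreal (exp (- (1 - \<theta>) * h)) * ennreal r ^ d" by (rule mult_left_mono) simp
    also have "\<dots> = ennreal (exp (- (1 - \<theta>) * h) * r ^ d)"
      using r(1) by (simp add: ennreal_power ennreal_mult)
    finally show ?thesis unfolding w_def nn_integral_cmult[OF meas] .
  qed
  have w_ge: "\<exists>a\<in>{1..n}. \<exists>d\<in>{1..n}. 1 \<le> w S a d \<omega>"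
    if alarm: "first_passage (cusum f0 f1 S \<omega>) h \<le> enat n" for S \<omega>
  proof -
    obtain a d where ad: "a \<in> {1..n}" "d \<in> {1..n}"
      and "h \<le> llr_sum f0 f1 S \<omega> (a + d) - llr_sum f0 f1 S \<omega> a" (is "h \<le> ?d")
      using alarm_imp[OF alarm h] .
    then have "(1 - \<theta>) * h \<le> (1 - \<theta>) * ?d" using \<theta> by (intro mult_left_mono) auto
    then have "1 \<le> exp (- (1 - \<theta>) * h + (1 - \<theta>) * ?d)"
      by (simp only: one_le_exp_iff mult_minus_left)
    also have "\<dots> = exp (- (1 - \<theta>) * h) * exp ((1 - \<theta>) * ?d)" by (rule exp_add)
    finally have "1 \<le> w S a d \<omega>" unfolding w_def by (simp flip: ennreal_mult)
    with ad show ?thesis by blast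
  qed
  have W_ge: "1 \<le> W \<omega>" if "T \<omega> < enat n" for \<omega>
  proof -
    have "\<exists>a\<in>{1..n}. \<exists>d\<in>{1..n}. 1 \<le> w S a d \<omega> \<or> 1 \<le> w S' a d \<omega>"
      using w_ge[of S \<omega>] w_ge[of S' \<omega>] T[of \<omega>] that
      by (meson less_imp_le min_le_iff_disj order_trans)
    then obtain a d where ad: "a \<in> {1..n}" "d \<in> {1..n}" "1 \<le> w S a d \<omega> + w S' a d \<omega>"
      by (auto intro: order_trans simp: add_increasing add_increasing2)
    note ad(3)
    also have "w S a d \<omega> + w S' a d \<omega> \<le> (\<Sum>d=1..n. w S a d \<omega> + w S' a d \<omega>)"
      using ad by (intro member_le_sum) auto
    also have "\<dots> \<le> W \<omega>"
      unfolding W_def using ad by (intro member_le_sum[of a _ "\<lambda>a. \<Sum>d=1..n. w S a d \<omega> + w S' a d \<omega>"]) auto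
    finally show ?thesis .
  qed
  note [measurable] = w_meas[OF S(1)] w_meas[OF S(2)]
  have [measurable]: "W \<in> borel_measurable ?P" unfolding W_def by measurable
  have "(\<integral>\<^sup>+\<omega>. W \<omega> \<partial>?P) = (\<Sum>a=1..n. \<Sum>d=1..n. (\<integral>\<^sup>+\<omega>. w S a d \<omega> \<partial>?P) + (\<integral>\<^sup>+\<omega>. w S' a d \<omega> \<partial>?P))"
    unfolding W_def by (simp add: nn_integral_sum nn_integral_add)
  also have "\<dots> \<le> (\<Sum>a=1..n. \<Sum>d=1..n. ennreal (exp (- (1 - \<theta>) * h) * r ^ d) + ennreal (exp (- (1 - \<theta>) * h) * r ^ d))"
    using S by (intro sum_mono add_mono w_int) auto
  also have "\<dots> = ennreal (\<Sum>a=1..n. \<Sum>d=1..n. 2 * (exp (- (1 - \<theta>) * h) * r ^ d))"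
  proof -
    have "ennreal y + ennreal y = ennreal (2 * y)" if "0 \<le> y" for y
      using that by (simp flip: ennreal_plus)
    then show ?thesis
      using r(1) by (simp only: sum_ennreal sum_nonneg mult_nonneg_nonneg exp_ge_zero zero_le_power zero_le_numeral)
  qed
  also have "(\<Sum>a=1..n. \<Sum>d=1..n. 2 * (exp (- (1 - \<theta>) * h) * r ^ d)) =
      2 * real n * exp (- (1 - \<theta>) * h) * (\<Sum>d=1..n. r ^ d)"
    by (simp add: sum_distrib_left mult_ac)
  also have "\<dots> \<le> 2 * real n * exp (- (1 - \<theta>) * h) * (1 / (1 - r))"
  proof (intro mult_left_mono)
    have "(\<Sum>d=1..n. r ^ d) \<le> (\<Sum>d. r ^ d)"
      using r by (intro sum_le_suminf) (auto simp: summable_geometric)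
    then show "(\<Sum>d=1..n. r ^ d) \<le> 1 / (1 - r)"
      using r by (simp add: suminf_geometric)
  qed auto
  also have "\<dots> \<le> 1 / 2"
  proof -
    have "real n * exp (- (1 - \<theta>) * h) \<le> (1 - r) / 4 * exp ((1 - \<theta>) * h) * exp (- (1 - \<theta>) * h)"
      using n by (intro mult_right_mono) auto
    also have "\<dots> = (1 - r) / 4 * exp ((1 - \<theta>) * h + - (1 - \<theta>) * h)"
      by (simp only: exp_add mult.assoc)
    also have "\<dots> = (1 - r) / 4" by (simp only: mult_minus_left add.right_inverse exp_zero mult_1_right)
    finally show ?thesis using r by (simp add: field_simps)
  qed
  finally have W_int: "(\<integral>\<^sup>+\<omega>. W \<omega> \<partial>?P) \<le> ennreal (1 / 2)" by (simp add: ennreal_leI)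
  \<comment> \<open>A measurable minorant of the alarm time: it vanishes wherever an alarm before \<open>n\<close> occurs.\<close>
  have pw: "of_nat n - of_nat n * W \<omega> \<le> ennreal_of_enat (T \<omega>)" for \<omega>
  proof (cases "T \<omega> < enat n")
    case True
    then have "of_nat n * 1 \<le> of_nat n * W \<omega>" using W_ge by (intro mult_left_mono) auto
    then show ?thesis by (simp add: diff_eq_0_ennreal of_nat_less_top)
  next
    case False
    then have "ennreal_of_enat (enat n) \<le> ennreal_of_enat (T \<omega>)"
      by (subst ennreal_of_enat_le_iff) simp
    then show ?thesis unfolding ennreal_of_enat_enat by (rule ennreal_diff_le_mono_left)
  qed
  have "of_nat n = (\<integral>\<^sup>+\<omega>. of_nat n \<partial>?P)" by (simp add: P.emeasure_space_1 del: space_report_law)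
  also have "\<dots> \<le> (\<integral>\<^sup>+\<omega>. (of_nat n - of_nat n * W \<omega>) + of_nat n * W \<omega> \<partial>?P)"
    using ennreal_minus_le_iff by (intro nn_integral_mono) (metis add.commute order_refl)
  also have "\<dots> = (\<integral>\<^sup>+\<omega>. of_nat n - of_nat n * W \<omega> \<partial>?P) + of_nat n * (\<integral>\<^sup>+\<omega>. W \<omega> \<partial>?P)"
    by (simp add: nn_integral_add nn_integral_cmult)
  also have "\<dots> \<le> (\<integral>\<^sup>+\<omega>. ennreal_of_enat (T \<omega>) \<partial>?P) + of_nat n * ennreal (1 / 2)"
    using W_int pw by (intro add_mono mult_left_mono nn_integral_mono) auto
  also have "of_nat n * ennreal (1 / 2) = ennreal (real n * (1 / 2))"
    unfolding ennreal_of_nat_eq_real_of_nat by (rule ennreal_mult[symmetric]) auto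
  finally have "ennreal (real n / 2) + ennreal (real n / 2) \<le>
      (\<integral>\<^sup>+\<omega>. ennreal_of_enat (T \<omega>) \<partial>?P) + ennreal (real n / 2)"
    by (simp add: ennreal_of_nat_eq_real_of_nat flip: ennreal_plus)
  then show ?thesis
    by (cases "(\<integral>\<^sup>+\<omega>. ennreal_of_enat (T \<omega>) \<partial>?P)")
      (auto simp flip: ennreal_plus simp: ennreal_le_iff)
qed

context
  fixes N K :: nat and G :: "nat \<Rightarrow> nat set"
  assumes partition: "G 1 \<union> G 2 \<union> G 3 = {1..N}"
      "G 1 \<inter> G 2 = {}" "G 1 \<inter> G 3 = {}" "G 2 \<inter> G 3 = {}"
    and group_size: "card (G 1) = K" "card (G 2) = K" "card (G 3) = K"
begin

lemma two_honest_groups: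
  assumes "nc \<in> {1..N}"
  obtains i j where "i \<in> {1, 2, 3}" "j \<in> {1, 2, 3}" "i \<noteq> j" "G i \<subseteq> {1..N} - {nc}" "G j \<subseteq> {1..N} - {nc}"
    "card (G i) = K" "card (G j) = K"
proof -
  have sub: "G 1 \<subseteq> {1..N}" "G 2 \<subseteq> {1..N}" "G 3 \<subseteq> {1..N}"
    using partition(1) by blast+
  have "nc \<in> G 1 \<or> nc \<in> G 2 \<or> nc \<in> G 3"
    using assms partition(1) by blast
  then consider "nc \<notin> G 2" "nc \<notin> G 3" | "nc \<notin> G 1" "nc \<notin> G 3" | "nc \<notin> G 1" "nc \<notin> G 2"
    using partition(2-4) by blast
  then show thesis
  proof cases
    case 1
    show thesis by (rule that[of 2 3]) (use 1 sub group_size in auto)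
  next
    case 2
    show thesis by (rule that[of 1 3]) (use 2 sub group_size in auto)
  next
    case 3
    show thesis by (rule that[of 1 2]) (use 3 sub group_size in auto)
  qed
qed

lemma detection_delay_le:
  assumes \<theta>: "0 < \<theta>" and r: "0 \<le> r" "r < 1" "chernoff \<theta> ^ K \<le> ennreal r"
    and n0: "exp (\<theta> * h) * r ^ n0 \<le> 1"
  shows "detection_delay N M f0 f1 (groupwise_rule f0 f1 G h) \<le> ennreal (real n0 + 1 + 2 / (1 - r))"
  unfolding detection_delay_def
proof (intro SUP_least esssup_I)
  let ?T = "groupwise_rule f0 f1 G h"
  fix \<tau> :: nat and nc s assume nc: "nc \<in> {1..N}" and s: "s \<in> attack_strategies M"
  let ?P = "report_law N M f0 f1 (enat \<tau>) nc s" and ?F = "report_filtration N M \<tau>"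
  let ?f = "\<lambda>\<omega>. ennreal_of_enat (?T \<omega> - enat \<tau>)"
  interpret P: prob_space ?P by (rule prob_space_report_law[OF nc s])
  interpret P: finite_measure_subalgebra ?P ?F
    by standard (rule subalgebra_report_filtration[OF nc s])
  show "nn_cond_exp ?P ?F ?f \<in> borel_measurable ?P" by simp
  show "AE \<omega> in ?P. nn_cond_exp ?P ?F ?f \<omega> \<le> ennreal (real n0 + 1 + 2 / (1 - r))"
  proof (cases "?f \<in> borel_measurable ?P")
    case True
    then show ?thesis
    proof (rule P.nn_cond_exp_le_const)
      fix A assume A: "A \<in> sets ?F"
      obtain i j where ij: "i \<in> {1, 2, 3}" "j \<in> {1, 2, 3}" "i \<noteq> j"
        and G: "G i \<subseteq> {1..N} - {nc}" "G j \<subseteq> {1..N} - {nc}" "card (G i) = K" "card (G j) = K"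
        using two_honest_groups[OF nc] .
      show "(\<integral>\<^sup>+\<omega>. ?f \<omega> * indicator A \<omega> \<partial>?P) \<le> ennreal (real n0 + 1 + 2 / (1 - r)) * emeasure ?P A"
        by (rule conditional_delay_bound[OF nc s G _ \<theta> r n0 A])
          (use second_of_three(2)[OF ij] in \<open>simp only: groupwise_rule_def\<close>)
    qed (simp add: P.emeasure_space_1 del: space_report_law)
  next
    case False
    \<comment> \<open>The conditional expectation of a nonmeasurable function is 0 by default.\<close>
    then show ?thesis by (simp add: nn_cond_exp_def)
  qed
qed

lemma ARL_ge:
  assumes "0 < h" "\<theta> < 1" "0 \<le> r" "r < 1" "chernoff \<theta> ^ K \<le> ennreal r"
    and "real n \<le> (1 - r) / 4 * exp ((1 - \<theta>) * h)"
  shows "ennreal (real n / 2) \<le> ARL N M f0 f1 (groupwise_rule f0 f1 G h)"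
  unfolding ARL_def
proof (intro INF_greatest)
  fix nc s assume nc: "nc \<in> {1..N}" and s: "s \<in> attack_strategies M"
  obtain i j where ij: "i \<in> {1, 2, 3}" "j \<in> {1, 2, 3}" "i \<noteq> j"
    and G: "G i \<subseteq> {1..N} - {nc}" "G j \<subseteq> {1..N} - {nc}" "card (G i) = K" "card (G j) = K"
    using two_honest_groups[OF nc] .
  show "ennreal (real n / 2) \<le>
      (\<integral>\<^sup>+\<omega>. ennreal_of_enat (groupwise_rule f0 f1 G h \<omega>) \<partial>report_law N M f0 f1 \<infinity> nc s)"
    by (rule run_length_bound[OF nc s G _ assms])
      (use second_of_three(1)[OF ij] in \<open>simp only: groupwise_rule_def\<close>)
qed

end

end

section \<open>The asymptotic bound\<close>

lemma ln_ennreal_ge: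
  assumes "0 < a" "ennreal a \<le> x"
  shows "ereal (ln a) \<le> ln_ennreal x"
proof (cases x)
  case (real b)
  then have "a \<le> b" using assms by (simp add: ennreal_le_iff)
  then show ?thesis using real assms by (simp add: ln_ennreal_def)
qed (simp add: ln_ennreal_def)

theorem theorem4p2:
  fixes M :: "'b measure" and f0 f1 :: "'b \<Rightarrow> real"
    and N :: nat and G :: "nat \<Rightarrow> nat set" and D \<kappa> \<beta> R :: real
  assumes sigma_finite: "sigma_finite_measure M"
    and f0_measurable: "f0 \<in> borel_measurable M" and f1_measurable: "f1 \<in> borel_measurable M"
    and f0_nonneg: "\<And>x. x \<in> space M \<Longrightarrow> 0 \<le> f0 x" and f1_nonneg: "\<And>x. x \<in> space M \<Longrightarrow> 0 \<le> f1 x"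
    and f0_density: "prob_space (density M (\<lambda>x. ennreal (f0 x)))"
    and f1_density: "prob_space (density M (\<lambda>x. ennreal (f1 x)))"
    and llr_finite: "AE x in M. f0 x = 0 \<longleftrightarrow> f1 x = 0"
    and distinct: "density M (\<lambda>x. ennreal (f0 x)) \<noteq> density M (\<lambda>x. ennreal (f1 x))"
    and second_moment: "integrable (density M (\<lambda>x. ennreal (f1 x))) (\<lambda>x. (llr f0 f1 x)\<^sup>2)"
    and N: "3 \<le> N" "3 dvd N"
    and partition: "G 1 \<union> G 2 \<union> G 3 = {1..N}"
      "G 1 \<inter> G 2 = {}" "G 1 \<inter> G 3 = {}" "G 2 \<inter> G 3 = {}"
    and group_size: "card (G 1) = N div 3" "card (G 2) = N div 3" "card (G 3) = N div 3"
    and D: "D = KL_divergence (exp 1) (density M (\<lambda>x. ennreal (f0 x))) (density M (\<lambda>x. ennreal (f1 x)))"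
    and \<kappa>: "(cusum_overshoot_mean (N div 3) M f0 f1 \<longlongrightarrow> \<kappa>) at_top"
    and \<beta>: "\<beta> = llr_minimum_mean (N div 3) M f0 f1"
    and R: "(llr_overshoot_exp_mean (N div 3) M f0 f1 \<longlongrightarrow> R) at_top"
  shows "\<exists>\<epsilon> \<in> o[at_top](\<lambda>h::real. 1 :: real). \<forall>\<^sub>F h in at_top.
    enn2ereal (detection_delay N M f0 f1 (groupwise_rule f0 f1 G h))
      \<le> ereal (2 / (D * real N / 3)) *
          (ln_ennreal (ARL N M f0 f1 (groupwise_rule f0 f1 G h))
           + ereal (ln ((1 - exp (- 1)) * R\<^sup>2 * D * real N / 3 / exp (- 1)) + \<beta> + \<kappa>))
        + ereal (\<epsilon> h)"
proof -
  interpret change_model M f0 f1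
    by (intro change_model.intro sigma_finite f0_measurable f1_measurable f0_nonneg f1_nonneg
        f0_density f1_density llr_finite)
  define K where "K = N div 3"
  define \<mu> where "\<mu> = D * real K"
  have "0 < K" using N by (auto simp: K_def)
  have "0 < D" unfolding D by (rule KL_pos[OF distinct second_moment])
  then have \<mu>: "0 < \<mu>" using \<open>0 < K\<close> by (simp add: \<mu>_def)
  have DN: "D * real N / 3 = \<mu>" using N(2) by (auto simp: \<mu>_def K_def)
  obtain \<theta> where \<theta>: "0 < \<theta>" "\<theta> \<le> 1 / 8" "chernoff \<theta> \<le> ennreal (exp (- (2 / 3) * \<theta> * D))"
    using chernoff_small[OF distinct second_moment, folded D] .
  define r where "r = exp (- (2 / 3) * \<theta> * \<mu>)"
  have r: "0 \<le> r" "r < 1" using \<theta> \<mu> by (auto simp: r_def)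
  have "chernoff \<theta> ^ K \<le> ennreal (exp (- (2 / 3) * \<theta> * D)) ^ K"
    using \<theta>(3) by (intro power_mono) auto
  also have "\<dots> = ennreal r"
    by (simp add: r_def \<mu>_def ennreal_power mult_ac flip: exp_of_nat_mult)
  finally have chernoff_r: "chernoff \<theta> ^ K \<le> ennreal r" .
  note groups = partition group_size[folded K_def]

  define B where "B h = 3 / 2 * h / \<mu> + 2 + 2 / (1 - r)" for h
  \<comment> \<open>The mean \<open>n / 2\<close> with \<open>n\<close> about \<open>(1 - r) / 4 * exp (7 / 8 * h)\<close> would give a factor 1/8; the
    factor 1/16 leaves room for rounding \<open>n\<close> down.\<close>
  define a where "a h = (1 - r) / 16 * exp (7 / 8 * h)" for h
  define c where "c = ln ((1 - exp (- 1)) * R\<^sup>2 * D * real N / 3 / exp (- 1)) + \<beta> + \<kappa>"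

  have delay: "detection_delay N M f0 f1 (groupwise_rule f0 f1 G h) \<le> ennreal (B h)" if h: "0 < h" for h
  proof -
    \<comment> \<open>The Chernoff bound \<open>exp (\<theta> * h) * r ^ n\<close> loses \<open>2 / 3 * \<theta> * \<mu>\<close> in the exponent per step, and so drops
      to 1 at this time.\<close>
    define n0 where "n0 = nat \<lceil>3 / 2 * h / \<mu>\<rceil>"
    have n0: "3 / 2 * h / \<mu> \<le> real n0" "real n0 \<le> 3 / 2 * h / \<mu> + 1"
      using h \<mu> by (simp_all add: n0_def of_nat_ceiling)
    have "exp (\<theta> * h) * r ^ n0 = exp (\<theta> * h + real n0 * (- (2 / 3) * \<theta> * \<mu>))"
      unfolding r_def exp_add by (simp only: exp_of_nat_mult)
    also have "\<dots> \<le> 1"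
    proof -
      have "h \<le> 2 / 3 * \<mu> * real n0" using n0(1) \<mu> by (simp add: field_simps)
      then have "\<theta> * h \<le> \<theta> * (2 / 3 * \<mu> * real n0)" using \<theta>(1) by (intro mult_left_mono) auto
      then show ?thesis by (simp add: mult_ac)
    qed
    finally have "detection_delay N M f0 f1 (groupwise_rule f0 f1 G h) \<le> ennreal (real n0 + 1 + 2 / (1 - r))"
      by (rule detection_delay_le[OF groups \<theta>(1) r chernoff_r])
    also have "\<dots> \<le> ennreal (B h)" using n0(2) by (intro ennreal_leI) (simp add: B_def)
    finally show ?thesis .
  qed

  have "\<forall>\<^sub>F h in at_top. 1 \<le> (1 - r) / 8 * exp (7 / 8 * h)"
    using r(2) by real_asymp
  then have ARL: "\<forall>\<^sub>F h in at_top. ennreal (a h) \<le> ARL N M f0 f1 (groupwise_rule f0 f1 G h)"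
    using eventually_gt_at_top[of 0]
  proof eventually_elim
    case (elim h)
    let ?x = "(1 - r) / 4 * exp ((1 - \<theta>) * h)"
    define n where "n = nat \<lfloor>?x\<rfloor>"
    have x0: "0 \<le> ?x" using r by simp
    have n: "real n \<le> ?x" "?x - 1 \<le> real n" using x0 by (auto simp: n_def of_nat_floor) linarith
    have "7 / 8 * h \<le> (1 - \<theta>) * h" using \<theta>(2) elim by (intro mult_right_mono) auto
    then have "(1 - r) / 4 * exp (7 / 8 * h) \<le> ?x" using r by (intro mult_left_mono) auto
    then have "a h \<le> real n / 2" using n(2) elim unfolding a_def by simp
    then have "ennreal (a h) \<le> ennreal (real n / 2)" by (rule ennreal_leI)
    also have "\<dots> \<le> ARL N M f0 f1 (groupwise_rule f0 f1 G h)"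
      using \<theta>(2) by (intro ARL_ge[OF groups _ _ r chernoff_r n(1)] elim) auto
    finally show ?case .
  qed

  \<comment> \<open>The difference of the two sides grows like \<open>h / (4 * \<mu>)\<close>, from \<open>2 * (7 / 8) - 3 / 2 = 1 / 4\<close>.\<close>
  have gap: "\<forall>\<^sub>F h in at_top. B h \<le> 2 / \<mu> * (ln (a h) + c)"
  proof -
    have ln_a: "ln (a h) = ln ((1 - r) / 16) + 7 / 8 * h" for h
      using r(2) unfolding a_def by (subst ln_mult) simp_all
    have "\<forall>\<^sub>F h in at_top. 4 * \<mu> * (2 + 2 / (1 - r)) - 8 * (ln ((1 - r) / 16) + c) \<le> h"
      by (rule eventually_ge_at_top)
    then show ?thesis
    proof eventually_elim
      case (elim h)
      then have "3 / 2 * h + \<mu> * (2 + 2 / (1 - r)) \<le> 2 * (ln (a h) + c)"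
        unfolding ln_a by simp
      then have "(3 / 2 * h + \<mu> * (2 + 2 / (1 - r))) / \<mu> \<le> 2 * (ln (a h) + c) / \<mu>"
        using \<mu> by (intro divide_right_mono) auto
      moreover have "(3 / 2 * h + \<mu> * (2 + 2 / (1 - r))) / \<mu> = B h"
        using \<mu> unfolding B_def by (simp add: add_divide_distrib)
      ultimately show ?case by simp
    qed
  qed

  show ?thesis
  proof (intro bexI[of _ "\<lambda>_. 0"])
    show "(\<lambda>_. 0) \<in> o[at_top](\<lambda>h::real. 1 :: real)" by simp
    show "\<forall>\<^sub>F h in at_top.
      enn2ereal (detection_delay N M f0 f1 (groupwise_rule f0 f1 G h))
      \<le> ereal (2 / (D * real N / 3)) *
          (ln_ennreal (ARL N M f0 f1 (groupwise_rule f0 f1 G h))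
           + ereal (ln ((1 - exp (- 1)) * R\<^sup>2 * D * real N / 3 / exp (- 1)) + \<beta> + \<kappa>))
        + ereal 0"
      using ARL gap eventually_gt_at_top[of 0] unfolding DN c_def[symmetric]
    proof eventually_elim
      case (elim h)
      have B0: "0 \<le> B h" using elim(3) \<mu> r by (simp add: B_def)
      have "enn2ereal (detection_delay N M f0 f1 (groupwise_rule f0 f1 G h)) \<le> ereal (B h)"
        using delay[OF elim(3)] B0 by (simp add: less_eq_ennreal.rep_eq enn2ereal_ennreal)
      also have "\<dots> \<le> ereal (2 / \<mu>) * (ereal (ln (a h)) + ereal c)" using elim(2) by simp
      also have "\<dots> \<le> ereal (2 / \<mu>) *
          (ln_ennreal (ARL N M f0 f1 (groupwise_rule f0 f1 G h)) + ereal c)"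
        using \<mu> r elim(1) by (intro ereal_mult_left_mono add_right_mono ln_ennreal_ge) (auto simp: a_def)
      finally show ?case by simp
    qed
  qed
qed

end
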